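(* Suppose that $D$ admits right derivatives everywhere on $[0,T)$ (denoted $D'_+(t)$) and that $\inf_{t\in[0,T)}D'_+(t)$ is positive. Then there is an algorithm which, for any positive integer $M$, whenever the problem P$^{\mathrm{ave}}_{\text{no return}}$ is feasible, computes in time $O(SM^3)$ a feasible solution $(\boldsymbol d,\boldsymbol y)$ of P$^{\mathrm{ave}}_{\text{no return}}$ satisfying $$g^{\mathrm{ave}}(\boldsymbol d,\boldsymbol y)\leq OPT+O\left(\frac{S^2}{M}\right),$$ where $OPT$ is the optimal value of P$^{\mathrm{ave}}_{\text{no return}}$.
   Context: Data: a positive integer $S$ (number of shuttles), a capacity $C\geq 0$, a period length $T$, a loading rate $\nu\geq 0$, and a nondecreasing upper semicontinuous function $D:[0,T]\to\mathbb{R}_+$ with $D(T)>0$ (cumulative demand). Pseudo-inverses of $D$: for $y\in[0,D(T)]$, $\tau(y)=\inf\{t\in[0,T]: D(t)>y\}$ if $y<D(T)$ and $\tau(D(T))=T$; $\bar\tau(y)=\inf\{t\in[0,T]: D(t)\geq y\}$. Problem P$^{\mathrm{ave}}_{\text{no return}}$: over nonnegative reals $\boldsymbol d=(d_1,\dots,d_S)$, $\boldsymbol y=(y_1,\dots,y_S)$, with $y_0=0$, minimize $$g^{\mathrm{ave}}(\boldsymbol d,\boldsymbol y)=\frac{1}{D(T)}\sum_{j=1}^S\int_{y_{j-1}}^{y_j}\big(d_j-\bar\tau(y)\big)\,dy$$ subject to: (i) $y_j-y_{j-1}\leq C$ for $j=1,\dots,S$; (ii) $y_{j-1}\leq y_j$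 for $j=1,\dots,S$; (iii) $d_{j-1}\leq d_j$ for $j=2,\dots,S$; (iv) $y_S=D(T)$; (v) $\bar\tau(y_j)+\nu(y_j-y_{j-1})\leq d_j$ for $j=1,\dots,S$. Computational model: the following operations take constant time: evaluation of $D(t)$ for any $t\in[0,T]$; integration of $D$ between two values; evaluation of $\tau(y)$ and $\bar\tau(y)$ for any $y$; evaluation of $\sup\{y:\bar\tau(y)+\nu y\leq\alpha\}$ for any $\alpha\in\mathbb{R}_+$. The quantities $C$, $T$, $D(\cdot)$, $\nu$ are constants of the computational model (the constants hidden in the $O$-notations may depend on them, but not on $S$ or $M$). *)

theory Defs
  imports "HOL-Analysis.Analysis"
begin

section \<open>The shuttle problem\<close>

record shuttle_data =
  capacity :: real
  period :: real
  loading :: real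
  demand :: "real \<Rightarrow> real"

text \<open>
  Demand functions are total in HOL; everything below looks at \<open>demand P\<close> on \<open>{0..period P}\<close> only.
\<close>

definition upper_semicontinuous_on :: "'a::topological_space set \<Rightarrow> ('a \<Rightarrow> real) \<Rightarrow> bool" where
  "upper_semicontinuous_on A f \<longleftrightarrow>
     (\<forall>x\<in>A. \<forall>c>f x. \<forall>\<^sub>F z in at x within A. f z < c)"

definition shuttle_instance :: "shuttle_data \<Rightarrow> bool" where
  "shuttle_instance P \<longleftrightarrow>
     0 \<le> capacity P \<and> 0 < period P \<and> 0 \<le> loading P \<and>
     (\<forall>t\<in>{0..period P}. 0 \<le> demand P t) \<and>
     mono_on {0..period P} (demand P) \<and>
     upper_semicontinuous_on {0..period P} (demand P) \<and>
     0 < demand P (period P)"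

definition total_demand :: "shuttle_data \<Rightarrow> real" where
  "total_demand P = demand P (period P)"

text \<open>The pseudo-inverses are meant for arguments in \<open>{0..total_demand P}\<close>.\<close>

definition tau :: "shuttle_data \<Rightarrow> real \<Rightarrow> real" where
  "tau P y = (if y < total_demand P then Inf {t\<in>{0..period P}. y < demand P t} else period P)"

definition taubar :: "shuttle_data \<Rightarrow> real \<Rightarrow> real" where
  "taubar P y = Inf {t\<in>{0..period P}. y \<le> demand P t}"

text \<open>
  Only \<open>d 1, \<dots>, d S\<close> and \<open>y 0, \<dots>, y S\<close> are significant.
\<close>

definition feasible ::
  "shuttle_data \<Rightarrow> nat \<Rightarrow> (nat \<Rightarrow> real) \<Rightarrow> (nat \<Rightarrow> real) \<Rightarrow> bool" where
  "feasible P S d y \<longleftrightarrow>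
     (\<forall>j\<in>{1..S}. 0 \<le> d j \<and> 0 \<le> y j) \<and> y 0 = 0 \<and>
     (\<forall>j\<in>{1..S}. y j - y (j - 1) \<le> capacity P) \<and>
     (\<forall>j\<in>{1..S}. y (j - 1) \<le> y j) \<and>
     (\<forall>j\<in>{2..S}. d (j - 1) \<le> d j) \<and>
     y S = total_demand P \<and>
     (\<forall>j\<in>{1..S}. taubar P (y j) + loading P * (y j - y (j - 1)) \<le> d j)"

definition g_ave ::
  "shuttle_data \<Rightarrow> nat \<Rightarrow> (nat \<Rightarrow> real) \<Rightarrow> (nat \<Rightarrow> real) \<Rightarrow> real" where
  "g_ave P S d y =
     1 / total_demand P * (\<Sum>j=1..S. integral {y (j - 1)..y j} (\<lambda>u. d j - taubar P u))"

definition OPT :: "shuttle_data \<Rightarrow> nat \<Rightarrow> real" where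
  "OPT P S = Inf {g_ave P S d y | d y. feasible P S d y}"


section \<open>Computational model\<close>

text \<open>
  A structured real RAM. The store consists of named arrays of natural numbers (used for counters
  and addressing) and named arrays of reals (accessed only through arithmetic and comparison);
  a scalar is cell 0 of an array. Literals are natural numbers, so that a program text cannot encode
  arbitrary real information. Neither rounding nor integer division is available. The demand
  function is accessible only through the unit-cost primitives \<open>Demand\<close>, \<open>DemandInt\<close>, \<open>Tau\<close>,
  \<open>Taubar\<close> and \<open>SupLoad\<close>, which return 0 outside of their domain.
\<close>

datatype nexp =
    NLit nat
  | NCell string nexp
  | NAdd nexp nexp
  | NSub nexp nexp
  | NMul nexp nexp

datatype rexp =
    OfNat nexp
  | RCell string nexp
  | RAdd rexp rexp
  | RSub rexp rexp
  | RMul rexp rexp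
  | RDiv rexp rexp
  | Capacity
  | Period
  | Loading
  | Demand rexp
  | DemandInt rexp rexp
  | Tau rexp
  | Taubar rexp
  | SupLoad rexp

datatype bexp =
    NLess nexp nexp
  | RLess rexp rexp
  | Not bexp
  | And bexp bexp

datatype com =
    Skip
  | NAssign string nexp nexp
  | RAssign string nexp rexp
  | Seq com com
  | If bexp com com
  | While bexp com

record store =
  narr :: "string \<Rightarrow> nat \<Rightarrow> nat"
  rarr :: "string \<Rightarrow> nat \<Rightarrow> real"

primrec nval :: "nexp \<Rightarrow> store \<Rightarrow> nat" where
  "nval (NLit k) s = k"
| "nval (NCell x a) s = narr s x (nval a s)"
| "nval (NAdd a b) s = nval a s + nval b s"
| "nval (NSub a b) s = nval a s - nval b s"
| "nval (NMul a b) s = nval a s * nval b s"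

definition demand_op :: "shuttle_data \<Rightarrow> real \<Rightarrow> real" where
  "demand_op P t = (if t \<in> {0..period P} then demand P t else 0)"

definition demand_int_op :: "shuttle_data \<Rightarrow> real \<Rightarrow> real \<Rightarrow> real" where
  "demand_int_op P a b = (if 0 \<le> a \<and> a \<le> b \<and> b \<le> period P then integral {a..b} (demand P) else 0)"

definition tau_op :: "shuttle_data \<Rightarrow> real \<Rightarrow> real" where
  "tau_op P y = (if y \<in> {0..total_demand P} then tau P y else 0)"

definition taubar_op :: "shuttle_data \<Rightarrow> real \<Rightarrow> real" where
  "taubar_op P y = (if y \<in> {0..total_demand P} then taubar P y else 0)"

definition sup_load_op :: "shuttle_data \<Rightarrow> real \<Rightarrow> real" where
  "sup_load_op P \<alpha> =
     (if 0 \<le> \<alpha> then Sup {y\<in>{0..total_demand P}. taubar P y + loading P * y \<le> \<alpha>} else 0)"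

primrec rval :: "shuttle_data \<Rightarrow> rexp \<Rightarrow> store \<Rightarrow> real" where
  "rval P (OfNat a) s = real (nval a s)"
| "rval P (RCell x a) s = rarr s x (nval a s)"
| "rval P (RAdd e f) s = rval P e s + rval P f s"
| "rval P (RSub e f) s = rval P e s - rval P f s"
| "rval P (RMul e f) s = rval P e s * rval P f s"
| "rval P (RDiv e f) s = rval P e s / rval P f s"
| "rval P Capacity s = capacity P"
| "rval P Period s = period P"
| "rval P Loading s = loading P"
| "rval P (Demand e) s = demand_op P (rval P e s)"
| "rval P (DemandInt e f) s = demand_int_op P (rval P e s) (rval P f s)"
| "rval P (Tau e) s = tau_op P (rval P e s)"
| "rval P (Taubar e) s = taubar_op P (rval P e s)"
| "rval P (SupLoad e) s = sup_load_op P (rval P e s)"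

primrec bval :: "shuttle_data \<Rightarrow> bexp \<Rightarrow> store \<Rightarrow> bool" where
  "bval P (NLess a b) s \<longleftrightarrow> nval a s < nval b s"
| "bval P (RLess e f) s \<longleftrightarrow> rval P e s < rval P f s"
| "bval P (Not b) s \<longleftrightarrow> \<not> bval P b s"
| "bval P (And b c) s \<longleftrightarrow> bval P b s \<and> bval P c s"

text \<open>Every node of an expression costs one time unit.\<close>

primrec ncost :: "nexp \<Rightarrow> nat" where
  "ncost (NLit k) = 1"
| "ncost (NCell x a) = 1 + ncost a"
| "ncost (NAdd a b) = 1 + ncost a + ncost b"
| "ncost (NSub a b) = 1 + ncost a + ncost b"
| "ncost (NMul a b) = 1 + ncost a + ncost b"

primrec rcost :: "rexp \<Rightarrow> nat" where
  "rcost (OfNat a) = 1 + ncost a"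
| "rcost (RCell x a) = 1 + ncost a"
| "rcost (RAdd e f) = 1 + rcost e + rcost f"
| "rcost (RSub e f) = 1 + rcost e + rcost f"
| "rcost (RMul e f) = 1 + rcost e + rcost f"
| "rcost (RDiv e f) = 1 + rcost e + rcost f"
| "rcost Capacity = 1"
| "rcost Period = 1"
| "rcost Loading = 1"
| "rcost (Demand e) = 1 + rcost e"
| "rcost (DemandInt e f) = 1 + rcost e + rcost f"
| "rcost (Tau e) = 1 + rcost e"
| "rcost (Taubar e) = 1 + rcost e"
| "rcost (SupLoad e) = 1 + rcost e"

primrec bcost :: "bexp \<Rightarrow> nat" where
  "bcost (NLess a b) = 1 + ncost a + ncost b"
| "bcost (RLess e f) = 1 + rcost e + rcost f"
| "bcost (Not b) = 1 + bcost b"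
| "bcost (And b c) = 1 + bcost b + bcost c"

definition nupd :: "string \<Rightarrow> nat \<Rightarrow> nat \<Rightarrow> store \<Rightarrow> store" where
  "nupd x i k s = s\<lparr>narr := (narr s)(x := (narr s x)(i := k))\<rparr>"

definition rupd :: "string \<Rightarrow> nat \<Rightarrow> real \<Rightarrow> store \<Rightarrow> store" where
  "rupd x i r s = s\<lparr>rarr := (rarr s)(x := (rarr s x)(i := r))\<rparr>"

text \<open>
  \<open>exec P c s n t\<close>: started in store \<open>s\<close>, the program \<open>c\<close> terminates in store \<open>t\<close> after
  \<open>n\<close> time units.
\<close>

inductive exec :: "shuttle_data \<Rightarrow> com \<Rightarrow> store \<Rightarrow> nat \<Rightarrow> store \<Rightarrow> bool"
  for P :: shuttle_data where
  Skip: "exec P Skip s 1 s"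
| NAssign: "exec P (NAssign x i a) s (1 + ncost i + ncost a) (nupd x (nval i s) (nval a s) s)"
| RAssign: "exec P (RAssign x i e) s (1 + ncost i + rcost e) (rupd x (nval i s) (rval P e s) s)"
| Seq: "exec P c1 s m t \<Longrightarrow> exec P c2 t n u \<Longrightarrow> exec P (Seq c1 c2) s (m + n) u"
| IfTrue: "bval P b s \<Longrightarrow> exec P c1 s n t \<Longrightarrow> exec P (If b c1 c2) s (1 + bcost b + n) t"
| IfFalse: "\<not> bval P b s \<Longrightarrow> exec P c2 s n t \<Longrightarrow> exec P (If b c1 c2) s (1 + bcost b + n) t"
| WhileFalse: "\<not> bval P b s \<Longrightarrow> exec P (While b c) s (1 + bcost b) s"
| WhileTrue: "bval P b s \<Longrightarrow> exec P c s m t \<Longrightarrow> exec P (While b c) t n u \<Longrightarrow>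
    exec P (While b c) s (1 + bcost b + m + n) u"

inductive_cases exec_SkipE: "exec P Skip s n t"
  and exec_NAssignE: "exec P (NAssign x i a) s n t"
  and exec_RAssignE: "exec P (RAssign x i e) s n t"
  and exec_SeqE: "exec P (Seq c1 c2) s n t"
  and exec_IfE: "exec P (If b c1 c2) s n t"
  and exec_WhileE: "exec P (While b c) s n t"

lemma exec_deterministic:
  assumes "exec P c s n t" and "exec P c s n' t'"
  shows "n' = n \<and> t' = t"
  using assms
proof (induction arbitrary: n' t' rule: exec.induct)
  case (Skip s)
  then show ?case by (rule exec_SkipE) simp
next
  case (NAssign x i a s)
  then show ?case by (rule exec_NAssignE) simp
next
  case (RAssign x i e s)
  then show ?case by (rule exec_RAssignE) simp
next
  case (Seq c1 s m t c2 n u)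
  from Seq.prems obtain m' t1 n1 where "n' = m' + n1" "exec P c1 s m' t1" "exec P c2 t1 n1 t'"
    by (rule exec_SeqE)
  with Seq.IH show ?case by metis
next
  case (IfTrue b s c1 n t c2)
  from IfTrue.prems obtain m where "n' = Suc (bcost b + m)" "exec P c1 s m t'"
    by (rule exec_IfE) (use IfTrue.hyps(1) in blast)+
  with IfTrue.IH show ?case by fastforce
next
  case (IfFalse b s c2 n t c1)
  from IfFalse.prems obtain m where "n' = Suc (bcost b + m)" "exec P c2 s m t'"
    by (rule exec_IfE) (use IfFalse.hyps(1) in blast)+
  with IfFalse.IH show ?case by fastforce
next
  case (WhileFalse b s c)
  from WhileFalse.prems show ?case
    by (rule exec_WhileE) (use WhileFalse.hyps(1) in simp_all)
next
  case (WhileTrue b s c m t n u)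
  from WhileTrue.prems obtain m' t1 n1
    where "n' = Suc (bcost b + m' + n1)" "exec P c s m' t1" "exec P (While b c) t1 n1 t'"
    by (rule exec_WhileE) (use WhileTrue.hyps(1) in blast)+
  with WhileTrue.IH show ?case by fastforce
qed

text \<open>
  Input: the numbers \<open>S\<close> and \<open>M\<close> in cell 0 of the arrays \<open>''S''\<close> and \<open>''M''\<close>, everything else
  being zero. Output: the real arrays \<open>''d''\<close> and \<open>''y''\<close> of the final store.
\<close>

definition input_store :: "nat \<Rightarrow> nat \<Rightarrow> store" where
  "input_store S M = nupd ''S'' 0 S (nupd ''M'' 0 M \<lparr>narr = (\<lambda>_ _. 0), rarr = (\<lambda>_ _. 0)\<rparr>)"

end

theory Submission
  imports Defs
begin

text \<open>
  The right derivatives of the demand are at least some \<open>c > 0\<close>, and a nondecreasing function only jumps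
  upwards, so the demand grows at rate at least \<open>c\<close> before the end of the period. Therefore its
  pseudo-inverse \<open>taubar\<close> is Lipschitz: changing the amounts carried by the shuttles by \<open>O(1/M)\<close> shifts
  the departure times that they allow by \<open>O(1/M)\<close> only. This makes a discretization possible.

  As \<open>y 0 = 0\<close> and \<open>y S = D(T)\<close>, the integrals of \<open>taubar\<close> in the objective add up to a constant, and
  what has to be minimized is the weighted sum of the \<open>d j * (y j - y (j - 1))\<close>. Round every \<open>y j\<close>
  down to a multiple of \<open>\<eta> = D(T) / M\<close> and every \<open>d j\<close> up to a multiple of \<open>\<delta> = (T + \<nu> D(T)) / M\<close>; later
  departures than \<open>T + \<nu> D(T)\<close> are pointless. An increment of \<open>y\<close> grows by less than \<open>\<eta>\<close>, so the
  rounded plan respects the capacity \<open>C + \<eta>\<close> and the loading constraint up to \<open>\<nu> \<eta>\<close>. The weights \<open>d j\<close>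
  are nondecreasing, so summation by parts (\<open>weighted_increments_lower_bound\<close>) bounds the increase of
  the cost by \<open>O(1/M)\<close>, uniformly in the number of shuttles (\<open>rounding_to_grid_plan\<close>).

  A cheapest relaxed grid plan is found by dynamic programming on the states ``shuttle \<open>j\<close>, cumulative
  load \<open>k \<eta>\<close>, departure at most \<open>l \<delta>\<close>''. The value is made monotone in \<open>l\<close> by comparing it with its
  neighbour at \<open>l - 1\<close>; a state then only has to look at its \<open>O(M)\<close> predecessors with the same \<open>l\<close>, and
  the \<open>S (M + 1)^2\<close> states take time \<open>O(S M^3)\<close>.

  The plan found this way exceeds the capacity by up to \<open>\<eta>\<close> per shuttle. It is repaired from the last
  shuttle backwards by \<open>z S = D(T)\<close> and \<open>z (j - 1) = max (y (j - 1)) (z j - C)\<close>, which is the smallest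
  increase of the loads that respects \<open>C\<close>. No load grows by more than \<open>S \<eta>\<close>. For fixed departures
  larger cumulative loads are cheaper, again by summation by parts, and by the Lipschitz bound the
  departures need to be delayed by \<open>O(S/M)\<close> only (\<open>earliest_departures_cost\<close>). The total
  loss is \<open>O(S/M)\<close>, hence \<open>O(S^2/M)\<close>.

  The algorithm is an explicit program, verified with time-bounded triples \<open>runs\<close>. The table is a
  linear array in the lexicographic order of \<open>(j, k, l)\<close>, and every entry depends on entries with smaller
  addresses; so ``all entries before \<open>c\<close> are correct'' is the single invariant of its three outer loops.
\<close>

section \<open>Lipschitz continuity of the pseudo-inverse and the objective\<close>

text \<open>
  The points at which \<open>f\<close> is not below the line of slope \<open>c\<close> through \<open>(a, f a)\<close> have a supremum. Monotonicity
  carries the inequality over to the supremum from the left, whatever jumps \<open>f\<close> has there, and the right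
  derivative carries it strictly beyond the supremum unless that is \<open>b\<close>.
\<close>

lemma growth_of_right_derivative_bound:
  fixes f :: "real \<Rightarrow> real"
  assumes mono: "mono_on {a..b} f" and ab: "a \<le> b" and c: "c > 0"
    and der: "\<And>t. a \<le> t \<Longrightarrow> t < b \<Longrightarrow> \<exists>f'>c. (f has_vector_derivative f') (at_right t)"
  shows "f a + c * (b - a) \<le> f b"
proof -
  define X where "X = {s \<in> {a..b}. f a + c * (s - a) \<le> f s}"
  define m where "m = Sup X"
  have aX: "a \<in> X" using ab by (simp add: X_def)
  have bdd: "bdd_above X" by (rule bdd_aboveI[of _ b]) (simp add: X_def)
  have am: "a \<le> m" unfolding m_def by (rule cSup_upper[OF aX bdd])
  have mb: "m \<le> b" unfolding m_def using aX by (intro cSup_least) (auto simp: X_def)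
  \<comment> \<open>\<open>f\<close> may jump at \<open>m\<close>, so points of \<open>X\<close> close to \<open>m\<close> are used, up to an error\<close>
  have "f a + c * (m - a) \<le> f m"
  proof (rule field_le_epsilon)
    fix e :: real assume e: "e > 0"
    have "m - e / c < Sup X" using e c by (simp add: m_def)
    then obtain s where s: "s \<in> X" "m - e / c < s" using less_cSup_iff[OF _ bdd] aX by blast
    have sm: "s \<le> m" unfolding m_def by (rule cSup_upper[OF s(1) bdd])
    have "f s \<le> f m" using s sm mb am by (intro mono_onD[OF mono]) (auto simp: X_def)
    moreover have "f a + c * (s - a) \<le> f s" using s by (simp add: X_def)
    moreover have "c * (m - e / c) \<le> c * s" using s(2) c by (intro mult_left_mono) auto
    then have "c * m - e \<le> c * s" using c by (simp add: algebra_simps)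
    ultimately show "f a + c * (m - a) \<le> f m + e" by (simp add: algebra_simps)
  qed
  then have mX: "m \<in> X" using am mb by (simp add: X_def)
  have "m = b"
  proof (rule ccontr)
    assume "m \<noteq> b"
    then have "m < b" using mb by simp
    then obtain f' where f': "f' > c" "(f has_vector_derivative f') (at_right m)"
      using der am by blast
    then have "((\<lambda>s. (f s - f m) / (s - m)) \<longlongrightarrow> f') (at_right m)"
      by (simp add: has_real_derivative_iff_has_vector_derivative[symmetric]
          has_field_derivative_iff)
    then have "\<forall>\<^sub>F s in at_right m. c < (f s - f m) / (s - m)"
      by (rule order_tendstoD(1)) (fact f'(1))
    moreover have "\<forall>\<^sub>F s in at_right m. s \<in> {m<..<b}"
      using \<open>m < b\<close> by (rule eventually_at_right_real)
    ultimately have "\<forall>\<^sub>F s in at_right m. c < (f s - f m) / (s - m) \<and> s \<in> {m<..<b}"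
      by (rule eventually_conj)
    then obtain s where s: "c < (f s - f m) / (s - m)" "m < s" "s < b"
      using eventually_happens trivial_limit_at_right_real by fastforce
    then have "c * (s - m) < f s - f m" by (simp add: less_divide_eq)
    moreover have "f a + c * (m - a) \<le> f m" using mX by (simp add: X_def)
    ultimately have "f a + c * (s - a) \<le> f s" by (simp add: algebra_simps)
    then have "s \<in> X" using s am by (simp add: X_def)
    then have "s \<le> m" unfolding m_def by (rule cSup_upper[OF _ bdd])
    then show False using s by simp
  qed
  then show ?thesis using mX by (simp add: X_def)
qed

lemma right_derivative_of_mono_nonneg:
  fixes f :: "real \<Rightarrow> real"
  assumes mono: "mono_on {a..b} f" and t: "a \<le> t" "t < b"
    and der: "(f has_vector_derivative f') (at_right t)"
  shows "0 \<le> f'"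
proof -
  have "((\<lambda>s. (f s - f t) / (s - t)) \<longlongrightarrow> f') (at_right t)"
    using der by (simp add: has_real_derivative_iff_has_vector_derivative[symmetric]
        has_field_derivative_iff)
  moreover have "\<forall>\<^sub>F s in at_right t. 0 \<le> (f s - f t) / (s - t)"
    using eventually_at_right_real[OF t(2)]
    by eventually_elim (use t in \<open>auto intro!: divide_nonneg_pos mono_onD[OF mono]\<close>)
  ultimately show ?thesis by (rule tendsto_lowerbound) (simp add: trivial_limit_at_right_real)
qed

lemma demand_growth:
  assumes inst: "shuttle_instance P"
    and diff: "\<forall>t\<in>{0..<period P}. demand P differentiable (at_right t)"
    and pos: "0 < (INF t\<in>{0..<period P}. vector_derivative (demand P) (at_right t))"
  obtains c where "c > 0"
    "\<And>s t. 0 \<le> s \<Longrightarrow> s \<le> t \<Longrightarrow> t < period P \<Longrightarrow> demand P s + c * (t - s) \<le> demand P t"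
proof -
  let ?D = "demand P" and ?T = "period P"
  let ?i = "INF t\<in>{0..<?T}. vector_derivative ?D (at_right t)"
  have mono: "mono_on {0..?T} ?D" using inst by (simp add: shuttle_instance_def)
  have der: "(?D has_vector_derivative vector_derivative ?D (at_right t)) (at_right t)"
    if "t \<in> {0..<?T}" for t using diff that vector_derivative_works by blast
  have "bdd_below ((\<lambda>t. vector_derivative ?D (at_right t)) ` {0..<?T})"
    by (rule bdd_belowI2[of _ 0]) (rule right_derivative_of_mono_nonneg[OF mono _ _ der]; simp)
  then have ge: "?i \<le> vector_derivative ?D (at_right t)" if "t \<in> {0..<?T}" for t
    using that by (intro cINF_lower)
  show thesis
  proof
    \<comment> \<open>half of the infimum, since a strict lower bound on the derivatives is required\<close>
    show "?i / 2 > 0" using pos by simp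
    show "?D s + ?i / 2 * (t - s) \<le> ?D t" if "0 \<le> s" "s \<le> t" "t < ?T" for s t
    proof (rule growth_of_right_derivative_bound)
      show "mono_on {s..t} ?D" by (rule mono_on_subset[OF mono]) (use that in auto)
      fix r assume "s \<le> r" "r < t"
      then have "r \<in> {0..<?T}" using that by auto
      with ge[of r] der[of r] pos
      show "\<exists>f'>?i / 2. (?D has_vector_derivative f') (at_right r)"
        by (intro exI[of _ "vector_derivative ?D (at_right r)"]) auto
    qed (use that pos in auto)
  qed
qed

lemma taubar_set:
  assumes "shuttle_instance P" "y \<le> total_demand P"
  shows "period P \<in> {t\<in>{0..period P}. y \<le> demand P t}"
    and "bdd_below {t\<in>{0..period P}. y \<le> demand P t}"
  using assms by (auto simp: shuttle_instance_def total_demand_def intro!: bdd_belowI[where m = 0])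

lemma taubar_le_period: "shuttle_instance P \<Longrightarrow> y \<le> total_demand P \<Longrightarrow> taubar P y \<le> period P"
  unfolding taubar_def by (rule cInf_lower[OF taubar_set])

lemma taubar_mono:
  assumes "shuttle_instance P" "y \<le> y'" "y' \<le> total_demand P"
  shows "taubar P y \<le> taubar P y'"
  unfolding taubar_def
proof (rule cInf_superset_mono)
  show "{t \<in> {0..period P}. y' \<le> demand P t} \<noteq> {}" using taubar_set(1)[of P y'] assms by force
  show "bdd_below {t \<in> {0..period P}. y \<le> demand P t}" using taubar_set(2)[of P y] assms by simp
qed (use assms in auto)

text \<open>
  If the demand has reached \<open>y\<close> at time \<open>s\<close>, then it reaches \<open>y'\<close> at time \<open>s + (y' - y) / c\<close> or at the end
  of the period. The infimum in \<open>taubar\<close> is approximated by such an \<open>s\<close>.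
\<close>

lemma taubar_lipschitz:
  assumes inst: "shuttle_instance P" and c: "c > 0"
    and growth: "\<And>s t. 0 \<le> s \<Longrightarrow> s \<le> t \<Longrightarrow> t < period P \<Longrightarrow> demand P s + c * (t - s) \<le> demand P t"
    and y: "y \<le> y'" "y' \<le> total_demand P"
  shows "taubar P y' \<le> taubar P y + (y' - y) / c"
proof (rule field_le_epsilon)
  fix e :: real assume e: "e > 0"
  let ?X = "\<lambda>y. {t\<in>{0..period P}. y \<le> demand P t}"
  have yle: "y \<le> total_demand P" using y by simp
  have ne: "?X y \<noteq> {}" using taubar_set(1)[OF inst yle] by force
  have bdd: "bdd_below (?X y)" by (rule taubar_set(2)[OF inst yle])
  have "Inf (?X y) < taubar P y + e" using e by (simp add: taubar_def)
  then obtain s where s: "s \<in> ?X y" "s < taubar P y + e"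
    using cInf_less_iff[OF ne bdd] by blast
  define t where "t = s + (y' - y) / c"
  have st: "s \<le> t" using y c by (simp add: t_def)
  have "taubar P y' \<le> t"
  proof (cases "t < period P")
    case True
    have "demand P s + c * (t - s) \<le> demand P t" using s st True by (intro growth) auto
    moreover have "c * (t - s) = y' - y" using c by (simp add: t_def)
    ultimately have "t \<in> ?X y'" using s st True by auto
    then show ?thesis unfolding taubar_def
      by (rule cInf_lower) (rule taubar_set(2)[OF inst y(2)])
  next
    case False
    then show ?thesis using taubar_le_period[OF inst y(2)] by linarith
  qed
  also have "t \<le> taubar P y + (y' - y) / c + e" using s by (simp add: t_def)
  finally show "taubar P y' \<le> taubar P y + (y' - y) / c + e" .
qed

definition taubar_slope_bound :: "shuttle_data \<Rightarrow> real \<Rightarrow> bool" where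
  "taubar_slope_bound P \<Lambda> \<longleftrightarrow> 0 \<le> \<Lambda> \<and>
     (\<forall>y y'. y \<le> y' \<longrightarrow> y' \<le> total_demand P \<longrightarrow> taubar P y' \<le> taubar P y + \<Lambda> * (y' - y))"

lemma taubar_slope_bound_exists:
  assumes "shuttle_instance P"
    and "\<forall>t\<in>{0..<period P}. demand P differentiable (at_right t)"
    and "0 < (INF t\<in>{0..<period P}. vector_derivative (demand P) (at_right t))"
  shows "\<exists>\<Lambda>. taubar_slope_bound P \<Lambda>"
proof -
  obtain c where c: "c > 0"
    "\<And>s t. 0 \<le> s \<Longrightarrow> s \<le> t \<Longrightarrow> t < period P \<Longrightarrow> demand P s + c * (t - s) \<le> demand P t"
    using demand_growth[OF assms] by blast
  then show ?thesis using taubar_lipschitz[OF assms(1) c]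
    by (intro exI[of _ "1 / c"]) (auto simp: taubar_slope_bound_def)
qed

lemma taubar_integrable:
  assumes inst: "shuttle_instance P" and lip: "taubar_slope_bound P \<Lambda>"
    and "b \<le> total_demand P"
  shows "taubar P integrable_on {a..b}"
proof (rule integrable_continuous_real)
  have "\<Lambda>-lipschitz_on {a..b} (taubar P)"
  proof (rule lipschitz_onI)
    show "dist (taubar P x) (taubar P y) \<le> \<Lambda> * dist x y" if "x \<in> {a..b}" "y \<in> {a..b}" for x y
      using that
    proof (induction x y rule: linorder_wlog)
      case (le x y)
      then have "x \<le> y" "y \<le> total_demand P" using assms by auto
      then have "taubar P y \<le> taubar P x + \<Lambda> * (y - x)" "taubar P x \<le> taubar P y"
        using lip taubar_mono[OF inst] unfolding taubar_slope_bound_def by blast+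
      then show ?case using le by (simp add: dist_real_def)
    qed (simp add: dist_commute)
  qed (use lip in \<open>simp add: taubar_slope_bound_def\<close>)
  then show "continuous_on {a..b} (taubar P)" by (rule lipschitz_on_continuous_on)
qed

text \<open>
  The integrals of \<open>taubar\<close> over the consecutive intervals add up to its integral over the whole range,
  which is the same for all solutions; only the weighted increments can be influenced.
\<close>

lemma g_ave_eq:
  assumes inst: "shuttle_instance P" and lip: "taubar_slope_bound P \<Lambda>"
    and y0: "y 0 = 0" and yS: "y S = total_demand P"
    and mono: "\<And>j. j \<in> {1..S} \<Longrightarrow> y (j - 1) \<le> y j"
  shows "g_ave P S d y =
    ((\<Sum>j=1..S. d j * (y j - y (j - 1))) - integral {0..total_demand P} (taubar P)) / total_demand P"
proof -
  let ?H = "\<lambda>x. integral {0..x} (taubar P)"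
  have lo: "0 \<le> y j" if "j \<le> S" for j using that
  proof (induction j)
    case (Suc j)
    then show ?case using mono[of "Suc j"] by simp
  qed (simp add: y0)
  have hi: "y j \<le> total_demand P" if "j \<le> S" for j using that
  proof (induction rule: inc_induct)
    case (step j)
    then show ?case using mono[of "Suc j"] by simp
  qed (simp add: yS)
  have one: "integral {y (j - 1)..y j} (\<lambda>u. d j - taubar P u) =
      d j * (y j - y (j - 1)) - (?H (y j) - ?H (y (j - 1)))" if "j \<in> {1..S}" for j
  proof -
    have "integral {y (j - 1)..y j} (\<lambda>u. d j - taubar P u) =
        d j * (y j - y (j - 1)) - integral {y (j - 1)..y j} (taubar P)"
      using that mono[of j] hi[of j] taubar_integrable[OF inst lip]
      by (subst Henstock_Kurzweil_Integration.integral_diff) auto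
    moreover have "?H (y (j - 1)) + integral {y (j - 1)..y j} (taubar P) = ?H (y j)"
      using that mono[of j] lo[of "j - 1"] hi[of j] taubar_integrable[OF inst lip]
      by (intro Henstock_Kurzweil_Integration.integral_combine) auto
    ultimately show ?thesis by simp
  qed
  have "(\<Sum>j=1..n. ?H (y j) - ?H (y (j - 1))) = ?H (y n) - ?H (y 0)" for n
    by (induction n) auto
  then have "(\<Sum>j=1..S. integral {y (j - 1)..y j} (\<lambda>u. d j - taubar P u)) =
      (\<Sum>j=1..S. d j * (y j - y (j - 1))) - ?H (total_demand P)"
    using one by (simp add: sum_subtractf y0 yS)
  then show ?thesis by (simp add: g_ave_def)
qed

text \<open>
  Summation by parts: the sum is \<open>e n * w n\<close> minus the sum of the \<open>(e (j + 1) - e j) * w j\<close>, where the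
  differences of \<open>e\<close> are nonnegative and add up to at most \<open>e n\<close>. Both the rounding of a
  solution (with \<open>c\<close> a grid step) and the repair of a grid plan (with \<open>c = 0\<close>) use it.
\<close>

lemma weighted_increments_lower_bound:
  fixes e w :: "nat \<Rightarrow> real"
  assumes "1 \<le> n" and "w 0 = 0" and "0 \<le> c" and "0 \<le> e 1"
    and "\<And>j. j \<le> n \<Longrightarrow> w j \<le> c"
    and "\<And>j. j \<in> {2..n} \<Longrightarrow> e (j - 1) \<le> e j"
  shows "e n * (w n - c) \<le> (\<Sum>j=1..n. e j * (w j - w (j - 1)))"
  using assms
proof (induction n rule: nat_induct_at_least)
  case base
  then show ?case by (simp add: mult_left_mono)
next
  case (Suc n)
  have "e n * (w n - c) \<le> (\<Sum>j=1..n. e j * (w j - w (j - 1)))" using Suc by auto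
  moreover have "0 \<le> (e (Suc n) - e n) * (c - w n)"
    using Suc.prems(4)[of n] Suc.prems(5)[of "Suc n"] Suc.hyps by (intro mult_nonneg_nonneg) auto
  ultimately show ?case by (simp add: algebra_simps)
qed

section \<open>Rounding to a grid and dynamic programming\<close>

definition ystep :: "shuttle_data \<Rightarrow> nat \<Rightarrow> real" where
  "ystep P M = total_demand P / real M"

definition latest :: "shuttle_data \<Rightarrow> real" where
  "latest P = period P + loading P * total_demand P"

definition dstep :: "shuttle_data \<Rightarrow> nat \<Rightarrow> real" where
  "dstep P M = latest P / real M"

text \<open>
  The constraints on shuttle \<open>j + 1\<close> if it raises the cumulative load from \<open>p\<close> to \<open>k\<close> grid steps and leaves
  at level \<open>l\<close>. Capacity and loading are relaxed by the effect of one grid step, so that rounded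
  solutions qualify. The total capacity of the first \<open>j\<close> shuttles is not relaxed: it keeps the
  repaired loads within reach of an empty start, and it forces \<open>p = 0\<close> for \<open>j = 0\<close>.
\<close>

definition admissible :: "shuttle_data \<Rightarrow> nat \<Rightarrow> nat \<Rightarrow> nat \<Rightarrow> nat \<Rightarrow> nat \<Rightarrow> bool" where
  "admissible P M j p k l \<longleftrightarrow>
     p \<le> k \<and>
     real p * ystep P M \<le> real j * capacity P \<and>
     real (k - p) * ystep P M \<le> capacity P + ystep P M \<and>
     taubar P (real k * ystep P M) + loading P * (real (k - p) * ystep P M)
       \<le> real l * dstep P M + loading P * ystep P M"

definition step_cost :: "shuttle_data \<Rightarrow> nat \<Rightarrow> nat \<Rightarrow> nat \<Rightarrow> nat \<Rightarrow> real" where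
  "step_cost P M p k l = real l * dstep P M * (real (k - p) * ystep P M)"

text \<open>
  A strict upper bound on the costs of all grid plans, serving as infinity.
\<close>

definition unreached :: "shuttle_data \<Rightarrow> real" where
  "unreached P = latest P * total_demand P + 1"

definition idx :: "nat \<Rightarrow> nat \<Rightarrow> nat \<Rightarrow> nat \<Rightarrow> nat" where
  "idx M j k l = (j * Suc M + k) * Suc M + l"

text \<open>
  Bellman's equation for the entry of shuttle \<open>j + 1\<close>, load \<open>k\<close> and level \<open>l\<close>, when the predecessors below
  \<open>m\<close> have been examined, as two inequalities and a witness: \<open>a\<close> holds the values, \<open>K\<close> the load
  before the shuttle and \<open>L\<close> the level at which it really leaves.
\<close>

definition entry_ok ::
  "shuttle_data \<Rightarrow> nat \<Rightarrow> (nat \<Rightarrow> real) \<Rightarrow> (nat \<Rightarrow> nat) \<Rightarrow> (nat \<Rightarrow> nat) \<Rightarrow> nat \<Rightarrow> nat \<Rightarrow> nat \<Rightarrow> nat \<Rightarrow> bool" where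
  "entry_ok P M a K L j k l m \<longleftrightarrow> (let c = idx M (Suc j) k l in
     (\<forall>p<m. admissible P M j p k l \<longrightarrow> a c \<le> a (idx M j p l) + step_cost P M p k l) \<and>
     (0 < l \<longrightarrow> a c \<le> a (idx M (Suc j) k (l - 1))) \<and>
     (a c < unreached P \<longrightarrow>
        L c \<le> l \<and> admissible P M j (K c) k (L c) \<and>
        a c = a (idx M j (K c) (L c)) + step_cost P M (K c) k (L c)))"

text \<open>
  The values before the first shuttle are zero for all loads; a nonzero load at that point is excluded
  by admissibility.
\<close>

definition table_ok ::
  "shuttle_data \<Rightarrow> nat \<Rightarrow> nat \<Rightarrow> (nat \<Rightarrow> real) \<Rightarrow> (nat \<Rightarrow> nat) \<Rightarrow> (nat \<Rightarrow> nat) \<Rightarrow> bool" where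
  "table_ok P S M a K L \<longleftrightarrow>
     (\<forall>i < idx M 1 0 0. a i = 0) \<and>
     (\<forall>j<S. \<forall>k\<le>M. \<forall>l\<le>M. entry_ok P M a K L j k l (Suc k))"

definition grid_plan ::
  "shuttle_data \<Rightarrow> nat \<Rightarrow> nat \<Rightarrow> (nat \<Rightarrow> nat) \<Rightarrow> (nat \<Rightarrow> nat) \<Rightarrow> bool" where
  "grid_plan P S M k l \<longleftrightarrow>
     k 0 = 0 \<and> k S = M \<and> (\<forall>j\<le>S. k j \<le> M) \<and>
     (\<forall>j\<in>{1..S}. admissible P M (j - 1) (k (j - 1)) (k j) (l j) \<and> l j \<le> M) \<and>
     (\<forall>j\<in>{2..S}. l (j - 1) \<le> l j)"

definition plan_cost ::
  "shuttle_data \<Rightarrow> nat \<Rightarrow> nat \<Rightarrow> (nat \<Rightarrow> nat) \<Rightarrow> (nat \<Rightarrow> nat) \<Rightarrow> real" where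
  "plan_cost P S M k l = (\<Sum>j=1..S. step_cost P M (k (j - 1)) (k j) (l j))"

lemma admissible_le: "admissible P M j p k l \<Longrightarrow> p \<le> k"
  by (simp add: admissible_def)

lemma entry_ok_predecessor:
  assumes "entry_ok P M a K L j k l m" "c = idx M (Suc j) k l" "a c < unreached P"
  shows "L c \<le> l \<and> admissible P M j (K c) k (L c) \<and>
    a c = a (idx M j (K c) (L c)) + step_cost P M (K c) k (L c)"
  using assms by (simp add: entry_ok_def Let_def)

lemma idx_less_next_layer:
  assumes "p \<le> M" "l \<le> M"
  shows "idx M j p l < idx M (Suc j) k q"
proof -
  have "p * Suc M + l \<le> M * Suc M + M" using assms by (intro add_mono mult_le_mono1)
  then show ?thesis by (simp add: idx_def algebra_simps)
qed

lemma idx_inject: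
  assumes "idx M j k l = idx M j' k' l'" "k \<le> M" "k' \<le> M" "l \<le> M" "l' \<le> M"
  shows "j = j' \<and> k = k' \<and> l = l'"
proof -
  have digits: "a = a' \<and> b = b'" if "a * n + b = a' * n + b'" "b < n" "b' < n" for a b a' b' n :: nat
    using arg_cong[OF that(1), of "\<lambda>x. x div n"] arg_cong[OF that(1), of "\<lambda>x. x mod n"] that(2,3) by simp
  have "j * Suc M + k = j' * Suc M + k' \<and> l = l'"
    using assms by (intro digits[of _ "Suc M"]) (auto simp: idx_def simp del: mult_Suc_right)
  moreover from this have "j = j' \<and> k = k'"
    using assms by (intro digits[of _ "Suc M"]) (auto simp del: mult_Suc_right)
  ultimately show ?thesis by simp
qed

lemma idx_Suc_layer: "idx M (Suc j) k l = idx M j k l + Suc M * Suc M"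
  by (simp add: idx_def algebra_simps)

lemma idx_row_end: "idx M j k (Suc M) = idx M j (Suc k) 0"
  by (simp add: idx_def algebra_simps)

lemma idx_layer_end: "idx M j (Suc M) 0 = idx M (Suc j) 0 0"
  by (simp add: idx_def algebra_simps)

lemma total_demand_pos: "shuttle_instance P \<Longrightarrow> 0 < total_demand P"
  by (simp add: shuttle_instance_def total_demand_def)

lemma latest_pos: "shuttle_instance P \<Longrightarrow> 0 < latest P"
  using total_demand_pos[of P] by (simp add: shuttle_instance_def latest_def add_pos_nonneg)

text \<open>
  The last bound is the total capacity of the first \<open>j\<close> shuttles, to which admissibility holds rounded loads.
\<close>

lemma feasible_bounds:
  assumes "feasible P S d y" "j \<le> S"
  shows "0 \<le> y j" "y j \<le> total_demand P" "y j \<le> real j * capacity P"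
proof -
  have inc: "y i \<le> y (Suc i)" "y (Suc i) - y i \<le> capacity P" if "i < S" for i
    using assms(1) that by (auto simp: feasible_def dest!: bspec[of _ _ "Suc i"])
  have y0: "y 0 = 0" and yS: "y S = total_demand P" using assms(1) by (auto simp: feasible_def)
  show "0 \<le> y j" using assms(2)
  proof (induction j)
    case (Suc j) then show ?case using inc(1)[of j] by simp
  qed (simp add: y0)
  show "y j \<le> real j * capacity P" using assms(2)
  proof (induction j)
    case (Suc j) then show ?case using inc(2)[of j] by (simp add: algebra_simps)
  qed (simp add: y0)
  show "y j \<le> total_demand P" using assms(2)
  proof (induction rule: inc_induct)
    case (step j) then show ?case using inc(1)[of j] by simp
  qed (simp add: yS)
qed

lemma grid_plan_mono:
  assumes "grid_plan P S M k l" "j \<in> {1..S}"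
  shows "k (j - 1) \<le> k j"
  using assms by (auto simp: grid_plan_def admissible_def)

lemma grid_plan_real_diff:
  assumes "grid_plan P S M k l" "j \<in> {1..S}"
  shows "real (k j - k (j - 1)) = real (k j) - real (k (j - 1))"
  using grid_plan_mono[OF assms] by (rule of_nat_diff)

context
  fixes P :: shuttle_data and M :: nat
  assumes inst: "shuttle_instance P" and M: "0 < M"
begin

lemma ystep_pos: "0 < ystep P M"
  using total_demand_pos[OF inst] M by (simp add: ystep_def)

lemma M_ystep: "real M * ystep P M = total_demand P"
  using M by (simp add: ystep_def)

lemma dstep_pos: "0 < dstep P M"
  using latest_pos[OF inst] M by (simp add: dstep_def)

lemma M_dstep: "real M * dstep P M = latest P"
  using M by (simp add: dstep_def)

lemma grid_le_total: "k \<le> M \<Longrightarrow> real k * ystep P M \<le> total_demand P"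
  using ystep_pos by (simp add: M_ystep[symmetric])

lemma step_cost_nonneg: "0 \<le> step_cost P M p k l"
  using ystep_pos dstep_pos by (simp add: step_cost_def)

lemma grid_plan_total:
  assumes "grid_plan P S M k l"
  shows "(\<Sum>j=1..S. real (k j - k (j - 1)) * ystep P M) = total_demand P"
proof -
  have "(\<Sum>j=1..S. real (k j - k (j - 1)) * ystep P M) =
      (\<Sum>j=1..S. (real (k j) - real (k (j - 1))) * ystep P M)"
    by (intro sum.cong refl) (simp only: grid_plan_real_diff[OF assms])
  also have "\<dots> = (real (k S) - real (k 0)) * ystep P M"
    by (induction S) (simp_all add: algebra_simps)
  finally show ?thesis using assms by (simp add: grid_plan_def M_ystep)
qed

lemma plan_cost_less_unreached:
  assumes "grid_plan P S M k l"
  shows "plan_cost P S M k l < unreached P"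
proof -
  have "plan_cost P S M k l \<le> (\<Sum>j=1..S. latest P * (real (k j - k (j - 1)) * ystep P M))"
    unfolding plan_cost_def step_cost_def
  proof (intro sum_mono mult_right_mono)
    fix j assume "j \<in> {1..S}"
    then have "l j \<le> M" using assms by (auto simp: grid_plan_def)
    then show "real (l j) * dstep P M \<le> latest P"
      using dstep_pos by (simp add: M_dstep[symmetric])
  qed (use ystep_pos in simp)
  also have "\<dots> = latest P * total_demand P"
    by (simp only: sum_distrib_left[symmetric] grid_plan_total[OF assms])
  finally show ?thesis by (simp add: unreached_def)
qed

text \<open>
  Loads are rounded down and departures up. Departures are first cut off at \<open>latest P\<close>, at which every
  shuttle can be ready, so that \<open>M\<close> levels suffice. The rounded departures cost at most one \<open>dstep\<close> per
  unit of demand, and the rounded loads stay within one \<open>ystep\<close> of the original ones, which summation by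
  parts turns into a loss of at most \<open>latest P * ystep P M\<close>.
\<close>

lemma rounding_to_grid_plan:
  assumes feas: "feasible P S d y" and S: "0 < S"
  obtains k l where "grid_plan P S M k l"
    and "plan_cost P S M k l \<le> (\<Sum>j=1..S. d j * (y j - y (j - 1)))
           + latest P * ystep P M + dstep P M * total_demand P"
proof -
  let ?\<eta> = "ystep P M" and ?\<delta> = "dstep P M" and ?\<nu> = "loading P" and ?C = "capacity P"
  note pos = ystep_pos dstep_pos total_demand_pos[OF inst] latest_pos[OF inst]
  have nu: "0 \<le> ?\<nu>" using inst by (simp add: shuttle_instance_def)
  define e where "e j = min (d j) (latest P)" for j
  define k where "k j = nat \<lfloor>y j / ?\<eta>\<rfloor>" for j
  define l where "l j = nat \<lceil>e j / ?\<delta>\<rceil>" for j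
  have yb: "0 \<le> y j" "y j \<le> total_demand P" "y j \<le> real j * ?C" if "j \<le> S" for j
    using feasible_bounds[OF feas that] by auto
  have y0: "y 0 = 0" and yS: "y S = total_demand P" using feas by (auto simp: feasible_def)
  have inc: "y (j - 1) \<le> y j" "y j - y (j - 1) \<le> ?C" "0 \<le> d j"
      "taubar P (y j) + ?\<nu> * (y j - y (j - 1)) \<le> d j" if "j \<in> {1..S}" for j
    using feas that by (auto simp: feasible_def)
  have kb: "real (k j) * ?\<eta> \<le> y j" "y j < real (k j) * ?\<eta> + ?\<eta>" if "j \<le> S" for j
  proof -
    have "0 \<le> y j / ?\<eta>" using yb(1)[OF that] pos by simp
    then have "real (k j) \<le> y j / ?\<eta>" "y j / ?\<eta> < real (k j) + 1" unfolding k_def by linarith+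
    then show "real (k j) * ?\<eta> \<le> y j" "y j < real (k j) * ?\<eta> + ?\<eta>"
      using pos by (auto simp: field_simps)
  qed
  have e0: "0 \<le> e j" if "j \<in> {1..S}" for j using inc(3)[OF that] pos by (simp add: e_def)
  have lb: "e j \<le> real (l j) * ?\<delta>" "real (l j) * ?\<delta> \<le> e j + ?\<delta>" if "j \<in> {1..S}" for j
  proof -
    have "0 \<le> e j / ?\<delta>" using e0[OF that] pos by simp
    then have "e j / ?\<delta> \<le> real (l j)" "real (l j) \<le> e j / ?\<delta> + 1" unfolding l_def by linarith+
    then show "e j \<le> real (l j) * ?\<delta>" "real (l j) * ?\<delta> \<le> e j + ?\<delta>"
      using pos by (auto simp: field_simps)
  qed
  have kM: "k j \<le> M" if "j \<le> S" for j
  proof -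
    have "y j / ?\<eta> \<le> real M" using yb(2)[OF that] pos by (simp add: divide_le_eq M_ystep)
    then show ?thesis unfolding k_def by linarith
  qed
  have kmono: "k (j - 1) \<le> k j" if "j \<in> {1..S}" for j
    unfolding k_def using inc(1)[OF that] pos by (intro nat_mono floor_mono divide_right_mono) auto
  have plan: "grid_plan P S M k l"
    unfolding grid_plan_def
  proof (intro conjI ballI allI impI)
    show "k 0 = 0" by (simp add: k_def y0)
    have "total_demand P / ?\<eta> = real M" using M_ystep pos by (simp add: field_simps)
    then show "k S = M" by (simp add: k_def yS)
    show "k j \<le> M" if "j \<le> S" for j using kM[OF that] .
    show "l (j - 1) \<le> l j" if "j \<in> {2..S}" for j
    proof -
      have "d (j - 1) \<le> d j" using feas that by (auto simp: feasible_def)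
      then have "e (j - 1) \<le> e j" by (auto simp: e_def)
      then show ?thesis
        unfolding l_def using pos by (intro nat_mono ceiling_mono divide_right_mono) auto
    qed
    fix j assume j: "j \<in> {1..S}"
    have jS: "j \<le> S" "j - 1 \<le> S" using j by auto
    have "e j / ?\<delta> \<le> real M" using pos by (simp add: divide_le_eq M_dstep e_def)
    then show "l j \<le> M" unfolding l_def by linarith
    have diff: "real (k j - k (j - 1)) = real (k j) - real (k (j - 1))"
      by (rule of_nat_diff[OF kmono[OF j]])
    have delta: "real (k j - k (j - 1)) * ?\<eta> \<le> y j - y (j - 1) + ?\<eta>"
      using kb(1)[OF jS(1)] kb(2)[OF jS(2)] by (simp add: diff[unfolded One_nat_def] algebra_simps)
    have load: "taubar P (y j) + ?\<nu> * (y j - y (j - 1)) \<le> e j"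
    proof -
      have "?\<nu> * (y j - y (j - 1)) \<le> ?\<nu> * total_demand P"
        using nu yb(2)[OF jS(1)] yb(1)[OF jS(2)] by (intro mult_left_mono) auto
      then have "taubar P (y j) + ?\<nu> * (y j - y (j - 1)) \<le> latest P"
        using taubar_le_period[OF inst yb(2)[OF jS(1)]] by (simp add: latest_def)
      then show ?thesis using inc(4)[OF j] by (simp add: e_def)
    qed
    have "taubar P (real (k j) * ?\<eta>) \<le> taubar P (y j)"
      using kb(1) yb(2) jS by (intro taubar_mono[OF inst]) auto
    moreover have "?\<nu> * (real (k j - k (j - 1)) * ?\<eta>) \<le> ?\<nu> * (y j - y (j - 1)) + ?\<nu> * ?\<eta>"
      using mult_left_mono[OF delta nu] by (simp add: algebra_simps)
    ultimately have "taubar P (real (k j) * ?\<eta>) + ?\<nu> * (real (k j - k (j - 1)) * ?\<eta>)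
        \<le> real (l j) * ?\<delta> + ?\<nu> * ?\<eta>" using load lb(1)[OF j] by linarith
    then show "admissible P M (j - 1) (k (j - 1)) (k j) (l j)"
      unfolding admissible_def
      using kmono[OF j] kb(1)[OF jS(2)] yb(3)[OF jS(2)] delta inc(2)[OF j]
      by (intro conjI) linarith+
  qed
  have "plan_cost P S M k l \<le> (\<Sum>j=1..S. (e j + ?\<delta>) * (real (k j - k (j - 1)) * ?\<eta>))"
    unfolding plan_cost_def step_cost_def
    using lb pos by (intro sum_mono mult_right_mono) auto
  also have "\<dots> = (\<Sum>j=1..S. e j * (real (k j - k (j - 1)) * ?\<eta>)) + ?\<delta> * total_demand P"
    by (simp only: distrib_right sum.distrib sum_distrib_left[symmetric] grid_plan_total[OF plan])
  also have "(\<Sum>j=1..S. e j * (real (k j - k (j - 1)) * ?\<eta>)) \<le>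
      (\<Sum>j=1..S. e j * (y j - y (j - 1))) + latest P * ?\<eta>"
  proof -
    \<comment> \<open>the rounding errors of the loads lie between 0 and one grid step, and vanish at both ends\<close>
    define w where "w j = y j - real (k j) * ?\<eta>" for j
    have "e S * (w S - ?\<eta>) \<le> (\<Sum>j=1..S. e j * (w j - w (j - 1)))"
    proof (rule weighted_increments_lower_bound)
      show "w 0 = 0" by (simp add: w_def y0 k_def)
      show "w j \<le> ?\<eta>" if "j \<le> S" for j using kb(2)[OF that] by (simp add: w_def)
      show "e (j - 1) \<le> e j" if "j \<in> {2..S}" for j
      proof -
        have "d (j - 1) \<le> d j" using feas that by (auto simp: feasible_def)
        then show ?thesis by (auto simp: e_def)
      qed
    qed (use S pos e0[of 1] in auto)
    moreover have "w S = 0" using plan M_ystep by (simp add: w_def yS grid_plan_def)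
    moreover have "(\<Sum>j=1..S. e j * (w j - w (j - 1))) =
        (\<Sum>j=1..S. e j * (y j - y (j - 1))) - (\<Sum>j=1..S. e j * (real (k j - k (j - 1)) * ?\<eta>))"
      unfolding sum_subtractf[symmetric]
      by (intro sum.cong refl)
        (simp add: grid_plan_real_diff[OF plan, unfolded One_nat_def] w_def algebra_simps)
    moreover have "e S * ?\<eta> \<le> latest P * ?\<eta>" using pos by (simp add: e_def)
    ultimately show ?thesis by (simp add: algebra_simps)
  qed
  also have "(\<Sum>j=1..S. e j * (y j - y (j - 1))) \<le> (\<Sum>j=1..S. d j * (y j - y (j - 1)))"
    by (intro sum_mono mult_right_mono) (use inc(1) in \<open>auto simp: e_def\<close>)
  finally have "plan_cost P S M k l \<le> (\<Sum>j=1..S. d j * (y j - y (j - 1)))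
      + latest P * ?\<eta> + ?\<delta> * total_demand P" by simp
  with plan show thesis by (rule that)
qed

text \<open>
  The inequalities of Bellman's equation are followed along the plan. Passing from the level of one
  shuttle to the higher level of the next uses that the values decrease with the level.
\<close>

lemma table_value_le_plan_cost:
  assumes tab: "table_ok P S M a K L" and plan: "grid_plan P S M k l"
  shows "a (idx M S M M) \<le> plan_cost P S M k l"
proof -
  have mono: "a (idx M (Suc j) m q) \<le> a (idx M (Suc j) m r)"
    if "j < S" "m \<le> M" "r \<le> q" "q \<le> M" for j m q r
    using that(3,4)
  proof (induction rule: dec_induct)
    case (step q)
    have "entry_ok P M a K L j m (Suc q) (Suc m)" using tab that step by (simp add: table_ok_def)
    then show ?case using step by (simp add: entry_ok_def Let_def)
  qed simp
  have "a (idx M n (k n) q) \<le> (\<Sum>j=1..n. step_cost P M (k (j - 1)) (k j) (l j))"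
    if "n \<le> S" "q \<le> M" "0 < n \<longrightarrow> l n \<le> q" for n q
    using that
  proof (induction n arbitrary: q)
    case 0
    then show ?case using tab idx_less_next_layer[of 0 M q 0 0 0] plan by (simp add: table_ok_def grid_plan_def)
  next
    case (Suc n)
    have n: "Suc n \<in> {1..S}" using Suc.prems by simp
    have adm: "admissible P M n (k n) (k (Suc n)) (l (Suc n))" and lM: "l (Suc n) \<le> M"
      and kM: "k (Suc n) \<le> M" using plan n by (auto simp: grid_plan_def dest: bspec[of _ _ "Suc n"])
    have "entry_ok P M a K L n (k (Suc n)) (l (Suc n)) (Suc (k (Suc n)))"
      using tab Suc.prems kM lM by (simp add: table_ok_def)
    moreover have "k n \<le> k (Suc n)" using adm by (simp add: admissible_def)
    ultimately have "a (idx M (Suc n) (k (Suc n)) (l (Suc n))) \<le>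
        a (idx M n (k n) (l (Suc n))) + step_cost P M (k n) (k (Suc n)) (l (Suc n))"
      using adm by (simp add: entry_ok_def Let_def less_Suc_eq_le)
    moreover have "a (idx M n (k n) (l (Suc n))) \<le> (\<Sum>j=1..n. step_cost P M (k (j - 1)) (k j) (l j))"
    proof (rule Suc.IH)
      show "0 < n \<longrightarrow> l n \<le> l (Suc n)"
        using plan Suc.prems by (auto simp: grid_plan_def dest: bspec[of _ _ "Suc n"])
    qed (use Suc.prems lM in auto)
    moreover have "a (idx M (Suc n) (k (Suc n)) q) \<le> a (idx M (Suc n) (k (Suc n)) (l (Suc n)))"
      using Suc.prems kM by (intro mono) auto
    ultimately show ?case by simp
  qed
  from this[of S M] show ?thesis using plan by (auto simp: grid_plan_def plan_cost_def)
qed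

end

text \<open>
  The state (load, level) after \<open>i\<close> steps of following the pointers down from the last shuttle.
\<close>

primrec backtrack :: "nat \<Rightarrow> nat \<Rightarrow> (nat \<Rightarrow> nat) \<Rightarrow> (nat \<Rightarrow> nat) \<Rightarrow> nat \<Rightarrow> nat \<times> nat" where
  "backtrack S M K L 0 = (M, M)"
| "backtrack S M K L (Suc i) =
     (let c = idx M (S - i) (fst (backtrack S M K L i)) (snd (backtrack S M K L i)) in (K c, L c))"

text \<open>
  A value below \<open>unreached P\<close> comes with a valid predecessor, whose value is not larger because costs are
  nonnegative. So the pointers can be followed to the start, and the values along the way telescope to
  the cost of the plan. The level of shuttle \<open>j\<close> is recorded in the state reached after passing it, which
  explains the shift between \<open>k\<close> and \<open>l\<close>.
\<close>

lemma backtracked_grid_plan: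
  assumes inst: "shuttle_instance P" and M: "0 < M" and S: "0 < S"
    and tab: "table_ok P S M a K L" and reached: "a (idx M S M M) < unreached P"
  defines "k \<equiv> \<lambda>j. fst (backtrack S M K L (S - j))" and "l \<equiv> \<lambda>j. snd (backtrack S M K L (Suc (S - j)))"
  shows "grid_plan P S M k l" and "plan_cost P S M k l = a (idx M S M M)"
proof -
  let ?t = "backtrack S M K L"
  have step: "fst (?t (Suc i)) \<le> fst (?t i) \<and> snd (?t (Suc i)) \<le> snd (?t i) \<and>
      admissible P M (S - Suc i) (fst (?t (Suc i))) (fst (?t i)) (snd (?t (Suc i))) \<and>
      a (idx M (S - i) (fst (?t i)) (snd (?t i))) =
        a (idx M (S - Suc i) (fst (?t (Suc i))) (snd (?t (Suc i)))) +
        step_cost P M (fst (?t (Suc i))) (fst (?t i)) (snd (?t (Suc i)))"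
    if "i < S" "fst (?t i) \<le> M" "snd (?t i) \<le> M"
      "a (idx M (S - i) (fst (?t i)) (snd (?t i))) < unreached P" for i
  proof -
    define c where "c = idx M (S - i) (fst (?t i)) (snd (?t i))"
    have next_state: "?t (Suc i) = (K c, L c)" by (simp add: c_def Let_def)
    have "entry_ok P M a K L (S - Suc i) (fst (?t i)) (snd (?t i)) (Suc (fst (?t i)))"
      using tab that by (simp add: table_ok_def)
    moreover have "c = idx M (Suc (S - Suc i)) (fst (?t i)) (snd (?t i))"
      using that by (simp add: c_def Suc_diff_Suc)
    moreover have "a c < unreached P" using that(4) by (simp add: c_def)
    ultimately have "L c \<le> snd (?t i) \<and> admissible P M (S - Suc i) (K c) (fst (?t i)) (L c) \<and>
        a c = a (idx M (S - Suc i) (K c) (L c)) + step_cost P M (K c) (fst (?t i)) (L c)"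
      by (rule entry_ok_predecessor)
    then show ?thesis using admissible_le unfolding next_state fst_conv snd_conv c_def[symmetric] by blast
  qed
  have inv: "fst (?t i) \<le> M \<and> snd (?t i) \<le> M \<and>
      a (idx M (S - i) (fst (?t i)) (snd (?t i))) < unreached P" if "i \<le> S" for i
    using that
  proof (induction i)
    case 0
    then show ?case using reached by simp
  next
    case (Suc i)
    then have "fst (?t i) \<le> M" "snd (?t i) \<le> M"
      "a (idx M (S - i) (fst (?t i)) (snd (?t i))) < unreached P" by auto
    with step[of i] Suc.prems step_cost_nonneg[OF inst M, of "fst (?t (Suc i))" "fst (?t i)" "snd (?t (Suc i))"]
    show ?case by (auto simp del: backtrack.simps)
  qed
  have kl: "k (j - 1) \<le> k j \<and> l j \<le> snd (?t (S - j)) \<and>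
      admissible P M (j - 1) (k (j - 1)) (k j) (l j) \<and>
      a (idx M j (k j) (snd (?t (S - j)))) =
        a (idx M (j - 1) (k (j - 1)) (l j)) + step_cost P M (k (j - 1)) (k j) (l j)"
    if "j \<in> {1..S}" for j
  proof -
    have *: "S - (S - j) = j" "Suc (S - j) = S - (j - 1)" "S - Suc (S - j) = j - 1" "S - j < S"
      using that by auto
    show ?thesis using step[of "S - j"] inv[of "S - j"] *(4) unfolding k_def l_def *(1,3)
      by (simp only: *(2))
  qed
  have lprev: "snd (?t (S - (j - 1))) = l j" if "j \<in> {1..S}" for j
  proof -
    have "Suc (S - j) = S - (j - 1)" using that by auto
    then show ?thesis by (simp only: l_def)
  qed
  have k0: "k 0 = 0"
  proof -
    have "real (k 0) * ystep P M \<le> 0" using kl[of 1] S by (simp add: admissible_def)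
    then show ?thesis using ystep_pos[OF inst M] by (simp add: mult_le_0_iff)
  qed
  show "grid_plan P S M k l"
    unfolding grid_plan_def
  proof (intro conjI ballI allI impI)
    show "k 0 = 0" by (rule k0)
    show "k S = M" by (simp add: k_def)
    show "k j \<le> M" if "j \<le> S" for j using inv[of "S - j"] by (simp add: k_def)
    fix j assume j: "j \<in> {1..S}"
    show "admissible P M (j - 1) (k (j - 1)) (k j) (l j)" using kl[OF j] by simp
    show "l j \<le> M" using kl[OF j] inv[of "S - j"] by auto
  next
    fix j assume j: "j \<in> {2..S}"
    then have "j - 1 \<in> {1..S}" by auto
    from kl[OF this] lprev[of j] j show "l (j - 1) \<le> l j" by (auto simp: diff_diff_eq)
  qed
  have "a (idx M n (k n) (snd (?t (S - n)))) = (\<Sum>j=1..n. step_cost P M (k (j - 1)) (k j) (l j))"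
    if "n \<le> S" for n using that
  proof (induction n)
    case 0
    have "snd (?t S) \<le> M" using inv[of S] by simp
    then show ?case using tab idx_less_next_layer[of 0 M "snd (?t S)" 0 0 0] k0 by (simp add: table_ok_def)
  next
    case (Suc n)
    then show ?case using kl[of "Suc n"] lprev[of "Suc n"] by simp
  qed
  from this[of S] show "plan_cost P S M k l = a (idx M S M M)"
    by (simp add: plan_cost_def k_def)
qed

section \<open>Repairing the capacity violations\<close>

definition repairs :: "shuttle_data \<Rightarrow> nat \<Rightarrow> nat \<Rightarrow> (nat \<Rightarrow> nat) \<Rightarrow> (nat \<Rightarrow> real) \<Rightarrow> bool" where
  "repairs P S M k z \<longleftrightarrow> z S = total_demand P \<and>
     (\<forall>j<S. z j = max (real (k j) * ystep P M) (z (Suc j) - capacity P))"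

definition earliest_departures :: "shuttle_data \<Rightarrow> nat \<Rightarrow> (nat \<Rightarrow> real) \<Rightarrow> (nat \<Rightarrow> real) \<Rightarrow> bool" where
  "earliest_departures P S z d \<longleftrightarrow> d 0 = 0 \<and>
     (\<forall>j<S. d (Suc j) = max (d j) (taubar P (z (Suc j)) + loading P * (z (Suc j) - z j)))"

text \<open>
  Two roundings cost \<open>latest P / M\<close> each; the rest pays for the delay of the departures after the repair,
  with \<open>\<Lambda>\<close> the Lipschitz constant of \<open>taubar\<close>.
\<close>

definition error_constant :: "shuttle_data \<Rightarrow> real \<Rightarrow> real" where
  "error_constant P \<Lambda> = 2 * latest P + (2 * loading P + \<Lambda>) * total_demand P"

context
  fixes P :: shuttle_data and S M :: nat and k l :: "nat \<Rightarrow> nat" and z :: "nat \<Rightarrow> real"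
  assumes inst: "shuttle_instance P" and M: "0 < M"
    and plan: "grid_plan P S M k l"
    and cap: "total_demand P \<le> real S * capacity P"
    and rep: "repairs P S M k z"
begin

text \<open>
  A grid plan exceeds the capacity by at most one grid step per shuttle, so the excess pushed
  back to shuttle \<open>j\<close> is at most one step for every shuttle after \<open>j\<close>. The bound \<open>j * capacity P\<close> is inherited
  from the plan, and gives \<open>z 0 = 0\<close>.
\<close>

lemma repair_bounds:
  assumes "j \<le> S"
  shows "real (k j) * ystep P M \<le> z j"
    and "z j \<le> real (k j) * ystep P M + real (S - j) * ystep P M"
    and "z j \<le> real j * capacity P"
    and "z j \<le> total_demand P"
proof -
  have zS: "z S = total_demand P" using rep by (simp add: repairs_def)
  have z: "z j = max (real (k j) * ystep P M) (z (Suc j) - capacity P)" if "j < S" for j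
    using rep that by (simp add: repairs_def)
  have kS: "real (k S) * ystep P M = total_demand P"
    using plan M_ystep[OF inst M] by (simp add: grid_plan_def)
  have C: "0 \<le> capacity P" using inst by (simp add: shuttle_instance_def)
  have adm: "real (k j) * ystep P M \<le> real j * capacity P"
    "real (k (Suc j)) * ystep P M - real (k j) * ystep P M \<le> capacity P + ystep P M" if "j < S" for j
    using plan that grid_plan_real_diff[OF plan, of "Suc j"]
    by (auto simp: grid_plan_def admissible_def algebra_simps dest!: bspec[of _ _ "Suc j"])
  show "real (k j) * ystep P M \<le> z j"
    using z[of j] zS kS assms by (cases "j = S") auto
  show "z j \<le> real (k j) * ystep P M + real (S - j) * ystep P M" using assms
  proof (induction rule: inc_induct)
    case (step j)
    have "real (S - j) = real (S - Suc j) + 1" using step by (simp add: Suc_diff_Suc[symmetric])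
    then have "real (S - j) * ystep P M = real (S - Suc j) * ystep P M + ystep P M"
      by (simp add: algebra_simps)
    moreover have "0 \<le> real (S - j) * ystep P M" using ystep_pos[OF inst M] by simp
    ultimately show ?case using z[of j] adm(2)[of j] step unfolding max_def by (auto split: if_splits)
  qed (simp add: zS kS)
  show "z j \<le> real j * capacity P" using assms
  proof (induction rule: inc_induct)
    case (step j)
    then show ?case using z[of j] adm(1)[of j] by (simp add: algebra_simps)
  qed (use zS cap in simp)
  show "z j \<le> total_demand P" using assms
  proof (induction rule: inc_induct)
    case (step j)
    have "k j \<le> M" using plan step by (simp add: grid_plan_def)
    then show ?case using z[of j] step grid_le_total[OF inst M, of "k j"] C by simp
  qed (simp add: zS)
qed

lemma repair_increments:
  assumes "j < S"
  shows "z j \<le> z (Suc j)" and "z (Suc j) - z j \<le> capacity P"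
proof -
  have z: "z j = max (real (k j) * ystep P M) (z (Suc j) - capacity P)"
    using rep assms by (simp add: repairs_def)
  have C: "0 \<le> capacity P" using inst by (simp add: shuttle_instance_def)
  have "k j \<le> k (Suc j)" using grid_plan_mono[OF plan, of "Suc j"] assms by simp
  then have "real (k j) * ystep P M \<le> real (k (Suc j)) * ystep P M"
    using ystep_pos[OF inst M] by simp
  then show "z j \<le> z (Suc j)" using z C repair_bounds(1)[of "Suc j"] assms by simp
  show "z (Suc j) - z j \<le> capacity P" using z by simp
qed

lemma repair_nonneg: "j \<le> S \<Longrightarrow> 0 \<le> z j"
  using repair_bounds(1)[of j] mult_nonneg_nonneg[of "real (k j)" "ystep P M"] ystep_pos[OF inst M]
  by linarith

lemma earliest_departures_feasible:
  assumes d: "earliest_departures P S z d"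
  shows "feasible P S d z"
proof -
  have z0: "z 0 = 0" using repair_bounds(3)[of 0] repair_nonneg[of 0] by simp
  have step: "d (Suc j) = max (d j) (taubar P (z (Suc j)) + loading P * (z (Suc j) - z j))"
    if "j < S" for j using d that by (simp add: earliest_departures_def)
  have dpos: "0 \<le> d j" if "j \<le> S" for j using that
  proof (induction j)
    case (Suc j) then show ?case using step[of j] by simp
  qed (use d in \<open>simp add: earliest_departures_def\<close>)
  have pred: "Suc (j - 1) = j" "j - 1 < S" if "j \<in> {1..S}" for j using that by auto
  show ?thesis
    unfolding feasible_def
  proof (intro conjI ballI)
    show "z 0 = 0" by (rule z0)
    show "z S = total_demand P" using rep by (simp add: repairs_def)
    fix j assume j: "j \<in> {1..S}"
    show "0 \<le> d j" "0 \<le> z j" using dpos repair_nonneg j by auto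
    show "z j - z (j - 1) \<le> capacity P" "z (j - 1) \<le> z j"
      using repair_increments[of "j - 1"] pred[OF j] by simp_all
    show "taubar P (z j) + loading P * (z j - z (j - 1)) \<le> d j"
      using step[of "j - 1"] pred[OF j] by simp
  next
    fix j assume "j \<in> {2..S}"
    then have "j \<in> {1..S}" by auto
    then show "d (j - 1) \<le> d j" using step[of "j - 1"] pred[of j] by simp
  qed
qed

text \<open>
  The repair raises loads by at most \<open>S\<close> grid steps. By the Lipschitz bound every shuttle is then ready at
  most \<open>?E\<close> after the departure planned on the grid, so delaying all departures by \<open>?E\<close> costs \<open>?E\<close> per
  unit of demand. Before the delay, the repaired loads are cheaper than those of the plan, by summation by parts
  with an upper bound of zero.
\<close>

lemma earliest_departures_cost:
  assumes lip: "taubar_slope_bound P \<Lambda>" and S: "0 < S"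
    and d: "earliest_departures P S z d"
  shows "(\<Sum>j=1..S. d j * (z j - z (j - 1))) \<le>
    plan_cost P S M k l + real S * (2 * loading P + \<Lambda>) * ystep P M * total_demand P"
proof -
  let ?\<eta> = "ystep P M" and ?\<delta> = "dstep P M" and ?\<nu> = "loading P"
  let ?E = "real S * (2 * ?\<nu> + \<Lambda>) * ?\<eta>"
  have pos: "0 < ?\<eta>" "0 < ?\<delta>" using ystep_pos[OF inst M] dstep_pos[OF inst M] by auto
  have nn: "0 \<le> ?\<nu>" "0 \<le> \<Lambda>" using inst lip by (auto simp: shuttle_instance_def taubar_slope_bound_def)
  have E: "0 \<le> ?E" using nn pos by simp
  have lmono: "l (j - 1) \<le> l j" if "j \<in> {2..S}" for j using plan that by (simp add: grid_plan_def)
  have load: "taubar P (z (Suc j)) + ?\<nu> * (z (Suc j) - z j) \<le> real (l (Suc j)) * ?\<delta> + ?E"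
    if "j < S" for j
  proof -
    let ?y = "\<lambda>j. real (k j) * ?\<eta>"
    have "Suc j \<in> {1..S}" using that by simp
    then have step: "admissible P M j (k j) (k (Suc j)) (l (Suc j))"
      using plan by (auto simp: grid_plan_def dest!: bspec[of _ _ "Suc j"])
    have "real (k (Suc j) - k j) = real (k (Suc j)) - real (k j)"
      by (rule of_nat_diff[OF admissible_le[OF step]])
    then have adm: "taubar P (?y (Suc j)) + ?\<nu> * (?y (Suc j) - ?y j)
        \<le> real (l (Suc j)) * ?\<delta> + ?\<nu> * ?\<eta>"
      using step by (simp add: admissible_def left_diff_distrib)
    have "real (S - Suc j) \<le> real S" by simp
    then have up: "z (Suc j) - ?y (Suc j) \<le> real S * ?\<eta>"
      using repair_bounds(2)[of "Suc j"] that mult_right_mono[of "real (S - Suc j)" "real S" ?\<eta>] pos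
      by linarith
    have "taubar P (z (Suc j)) \<le> taubar P (?y (Suc j)) + \<Lambda> * (z (Suc j) - ?y (Suc j))"
      using lip repair_bounds[of "Suc j"] that unfolding taubar_slope_bound_def by simp
    moreover have "\<Lambda> * (z (Suc j) - ?y (Suc j)) \<le> \<Lambda> * (real S * ?\<eta>)"
      using up nn by (intro mult_left_mono)
    moreover have "?\<nu> * (z (Suc j) - z j) \<le> ?\<nu> * (?y (Suc j) - ?y j + real S * ?\<eta>)"
      using up repair_bounds(1)[of j] that nn by (intro mult_left_mono) auto
    moreover have "?\<nu> * ?\<eta> \<le> ?\<nu> * (real S * ?\<eta>)"
      using S nn pos by (intro mult_left_mono) auto
    ultimately show ?thesis using adm by (simp add: algebra_simps)
  qed
  have db: "d j \<le> real (l j) * ?\<delta> + ?E" if "j \<in> {1..S}" for j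
  proof -
    have "1 \<le> j" "j \<le> S" using that by auto
    then show ?thesis
    proof (induction j rule: dec_induct)
      case base
      have "d 1 = max 0 (taubar P (z 1) + ?\<nu> * (z 1 - z 0))"
        using d S by (auto simp: earliest_departures_def)
      then show ?case using load[of 0] S E pos by (simp add: add_nonneg_nonneg)
    next
      case (step j)
      have "d (Suc j) = max (d j) (taubar P (z (Suc j)) + ?\<nu> * (z (Suc j) - z j))"
        using d step by (auto simp: earliest_departures_def)
      moreover have "real (l j) * ?\<delta> \<le> real (l (Suc j)) * ?\<delta>"
        using lmono[of "Suc j"] step pos by simp
      ultimately show ?case using load[of j] step by auto
    qed
  qed
  have inc: "z (j - 1) \<le> z j" if "j \<in> {1..S}" for j using repair_increments(1)[of "j - 1"] that by auto
  have z0: "z 0 = 0" using repair_bounds(3)[of 0] repair_nonneg[of 0] by simp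
  have zS: "z S = total_demand P" using rep by (simp add: repairs_def)
  have "(\<Sum>j=1..S. d j * (z j - z (j - 1))) \<le> (\<Sum>j=1..S. (real (l j) * ?\<delta> + ?E) * (z j - z (j - 1)))"
    using db inc by (intro sum_mono mult_right_mono) auto
  also have "\<dots> = (\<Sum>j=1..S. real (l j) * ?\<delta> * (z j - z (j - 1))) + ?E * (\<Sum>j=1..S. z j - z (j - 1))"
    by (simp only: distrib_right sum.distrib sum_distrib_left)
  also have "(\<Sum>j=1..S. z j - z (j - 1)) = z S - z 0" by (induction S) auto
  also have "(\<Sum>j=1..S. real (l j) * ?\<delta> * (z j - z (j - 1))) \<le> plan_cost P S M k l"
  proof -
    define w where "w j = real (k j) * ?\<eta> - z j" for j
    have "real (l S) * ?\<delta> * (w S - 0) \<le> (\<Sum>j=1..S. real (l j) * ?\<delta> * (w j - w (j - 1)))"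
    proof (rule weighted_increments_lower_bound)
      show "w 0 = 0" using plan z0 by (simp add: w_def grid_plan_def)
      show "w j \<le> 0" if "j \<le> S" for j using repair_bounds(1)[OF that] by (simp add: w_def)
      show "real (l (j - 1)) * ?\<delta> \<le> real (l j) * ?\<delta>" if "j \<in> {2..S}" for j
        using lmono[OF that] pos by simp
    qed (use S pos in auto)
    moreover have "w S = 0" using plan zS M_ystep[OF inst M] by (simp add: w_def grid_plan_def)
    moreover have "(\<Sum>j=1..S. real (l j) * ?\<delta> * (w j - w (j - 1))) =
        plan_cost P S M k l - (\<Sum>j=1..S. real (l j) * ?\<delta> * (z j - z (j - 1)))"
      unfolding plan_cost_def step_cost_def sum_subtractf[symmetric]
      by (intro sum.cong refl)
        (simp add: grid_plan_real_diff[OF plan, unfolded One_nat_def] w_def algebra_simps)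
    ultimately show ?thesis by simp
  qed
  finally show ?thesis by (simp add: z0 zS)
qed

end

lemma feasible_total_capacity:
  assumes "feasible P S d y"
  shows "total_demand P \<le> real S * capacity P"
  using feasible_bounds(3)[OF assms, of S] assms by (simp add: feasible_def)

lemma backtracked_grid_plan_of_feasible:
  assumes inst: "shuttle_instance P" and M: "0 < M" and S: "0 < S"
    and feas: "feasible P S d' y'"
    and tab: "table_ok P S M a K L"
  defines "k \<equiv> \<lambda>j. fst (backtrack S M K L (S - j))"
    and "l \<equiv> \<lambda>j. snd (backtrack S M K L (Suc (S - j)))"
  shows "grid_plan P S M k l" and "plan_cost P S M k l = a (idx M S M M)"
proof -
  obtain k' l' where plan: "grid_plan P S M k' l'"
    using rounding_to_grid_plan[OF inst M feas S] by blast
  have "a (idx M S M M) < unreached P"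
    using table_value_le_plan_cost[OF inst M tab plan] plan_cost_less_unreached[OF inst M plan]
    by linarith
  from backtracked_grid_plan[OF inst M S tab this]
  show "grid_plan P S M k l" "plan_cost P S M k l = a (idx M S M M)" by (auto simp: k_def l_def)
qed

text \<open>
  The optimal value is an infimum, so the computed solution is compared with every feasible solution,
  by way of the rounding of the latter to the grid.
\<close>

lemma backtracked_solution_near_optimal:
  assumes inst: "shuttle_instance P" and lip: "taubar_slope_bound P \<Lambda>" and M: "0 < M" and S: "0 < S"
    and feas: "\<exists>d y. feasible P S d y"
    and tab: "table_ok P S M a K L"
    and rep: "repairs P S M (\<lambda>j. fst (backtrack S M K L (S - j))) z"
    and d: "earliest_departures P S z d"
  shows "feasible P S d z"
    and "g_ave P S d z \<le> OPT P S + error_constant P \<Lambda> * (real S ^ 2 / real M)"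
proof -
  let ?k = "\<lambda>j. fst (backtrack S M K L (S - j))" and ?l = "\<lambda>j. snd (backtrack S M K L (Suc (S - j)))"
  let ?D = "total_demand P" and ?H = "integral {0..total_demand P} (taubar P)"
  obtain d0 y0 where f0: "feasible P S d0 y0" using feas by blast
  note plan = backtracked_grid_plan_of_feasible[OF inst M S f0 tab]
  note cap = feasible_total_capacity[OF f0]
  show feasible: "feasible P S d z"
    by (rule earliest_departures_feasible[OF inst M plan(1) cap rep d])
  have g: "g_ave P S d y = ((\<Sum>j=1..S. d j * (y j - y (j - 1))) - ?H) / ?D"
    if "feasible P S d y" for d y
    using that by (intro g_ave_eq[OF inst lip]) (auto simp: feasible_def)
  have Dpos: "0 < ?D" by (rule total_demand_pos[OF inst])
  have nn: "0 \<le> 2 * loading P + \<Lambda>" "0 < latest P"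
    using inst lip latest_pos[OF inst] by (auto simp: shuttle_instance_def taubar_slope_bound_def)
  have "g_ave P S d z - error_constant P \<Lambda> * (real S ^ 2 / real M) \<le> g_ave P S d1 y1"
    if f1: "feasible P S d1 y1" for d1 y1
  proof -
    obtain k1 l1 where p1: "grid_plan P S M k1 l1"
      and c1: "plan_cost P S M k1 l1 \<le> (\<Sum>j=1..S. d1 j * (y1 j - y1 (j - 1)))
           + latest P * ystep P M + dstep P M * ?D"
      using rounding_to_grid_plan[OF inst M f1 S] by blast
    have "(\<Sum>j=1..S. d j * (z j - z (j - 1))) \<le>
        plan_cost P S M ?k ?l + real S * (2 * loading P + \<Lambda>) * ystep P M * ?D"
      by (rule earliest_departures_cost[OF inst M plan(1) cap rep lip S d])
    also have "plan_cost P S M ?k ?l \<le> plan_cost P S M k1 l1"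
      using table_value_le_plan_cost[OF inst M tab p1] plan(2) by simp
    finally have "(\<Sum>j=1..S. d j * (z j - z (j - 1))) \<le> (\<Sum>j=1..S. d1 j * (y1 j - y1 (j - 1))) +
        (2 * latest P + real S * (2 * loading P + \<Lambda>) * ?D) / real M * ?D"
      using c1 by (simp add: ystep_def dstep_def add_divide_distrib algebra_simps)
    moreover have "(A - ?H) / ?D \<le> (B - ?H) / ?D + X" if "A \<le> B + X * ?D" for A B X
      using that Dpos by (simp add: field_simps)
    ultimately have "g_ave P S d z \<le> g_ave P S d1 y1 +
        (2 * latest P + real S * (2 * loading P + \<Lambda>) * ?D) / real M"
      unfolding g[OF feasible] g[OF f1] by blast
    moreover have "(2 * latest P + real S * (2 * loading P + \<Lambda>) * ?D) / real M \<le>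
        error_constant P \<Lambda> * real S ^ 2 / real M"
    proof (rule divide_right_mono)
      have S1: "1 \<le> real S" using S by simp
      have "latest P * 1 \<le> latest P * real S ^ 2"
        using S1 nn by (intro mult_left_mono one_le_power) auto
      moreover have "real S * ((2 * loading P + \<Lambda>) * ?D) \<le> real S ^ 2 * ((2 * loading P + \<Lambda>) * ?D)"
        using S1 nn Dpos by (intro mult_right_mono self_le_power) auto
      ultimately show "2 * latest P + real S * (2 * loading P + \<Lambda>) * ?D \<le> error_constant P \<Lambda> * real S ^ 2"
        by (simp add: error_constant_def algebra_simps)
    qed simp
    ultimately show ?thesis by simp
  qed
  then have "g_ave P S d z - error_constant P \<Lambda> * (real S ^ 2 / real M) \<le> OPT P S"
    unfolding OPT_def using feas by (intro cInf_greatest) auto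
  then show "g_ave P S d z \<le> OPT P S + error_constant P \<Lambda> * (real S ^ 2 / real M)" by simp
qed

section \<open>Program runs with a time bound\<close>

definition runs :: "shuttle_data \<Rightarrow> com \<Rightarrow> store \<Rightarrow> nat \<Rightarrow> (store \<Rightarrow> bool) \<Rightarrow> bool" where
  "runs P c s N Q \<longleftrightarrow> (\<exists>n t. exec P c s n t \<and> n \<le> N \<and> Q t)"

lemma runs_weaken: "runs P c s N Q \<Longrightarrow> N \<le> N' \<Longrightarrow> (\<And>t. Q t \<Longrightarrow> Q' t) \<Longrightarrow> runs P c s N' Q'"
  unfolding runs_def by (meson order_trans)

lemma runs_Seq:
  assumes "runs P c1 s N1 R" and "\<And>t. R t \<Longrightarrow> runs P c2 t N2 Q"
  shows "runs P (Seq c1 c2) s (N1 + N2) Q"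
proof -
  obtain n t where 1: "exec P c1 s n t" "n \<le> N1" "R t" using assms(1) by (auto simp: runs_def)
  obtain m u where 2: "exec P c2 t m u" "m \<le> N2" "Q u" using assms(2)[OF 1(3)] by (auto simp: runs_def)
  show ?thesis unfolding runs_def using exec.Seq[OF 1(1) 2(1)] 1(2) 2(2,3) by (meson add_mono)
qed

primrec loopfree :: "com \<Rightarrow> bool" where
  "loopfree Skip = True"
| "loopfree (NAssign x i a) = True"
| "loopfree (RAssign x i e) = True"
| "loopfree (Seq c1 c2) = (loopfree c1 \<and> loopfree c2)"
| "loopfree (If b c1 c2) = (loopfree c1 \<and> loopfree c2)"
| "loopfree (While b c) = False"

primrec effect :: "shuttle_data \<Rightarrow> com \<Rightarrow> store \<Rightarrow> store" where
  "effect P Skip s = s"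
| "effect P (NAssign x i a) s = nupd x (nval i s) (nval a s) s"
| "effect P (RAssign x i e) s = rupd x (nval i s) (rval P e s) s"
| "effect P (Seq c1 c2) s = effect P c2 (effect P c1 s)"
| "effect P (If b c1 c2) s = (if bval P b s then effect P c1 s else effect P c2 s)"
| "effect P (While b c) s = s"

text \<open>
  Both branches of a conditional are added up: their sum dominates the cost of either one.
\<close>

primrec max_cost :: "com \<Rightarrow> nat" where
  "max_cost Skip = 1"
| "max_cost (NAssign x i a) = 1 + ncost i + ncost a"
| "max_cost (RAssign x i e) = 1 + ncost i + rcost e"
| "max_cost (Seq c1 c2) = max_cost c1 + max_cost c2"
| "max_cost (If b c1 c2) = 1 + bcost b + (max_cost c1 + max_cost c2)"
| "max_cost (While b c) = 0"

text \<open>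
  Loop-free code is executed symbolically: a claim about its runs becomes one about the function
  \<open>effect\<close>, which the simplifier evaluates, and its cost stays a constant that need not be computed.
\<close>

lemma runs_loopfree:
  assumes "loopfree c" "Q (effect P c s)"
  shows "runs P c s (max_cost c) Q"
proof -
  have "\<exists>n. exec P c s n (effect P c s) \<and> n \<le> max_cost c" using assms(1)
  proof (induction c arbitrary: s)
    case (Seq c1 c2)
    obtain n1 where "exec P c1 s n1 (effect P c1 s)" "n1 \<le> max_cost c1" using Seq by auto
    moreover obtain n2 where "exec P c2 (effect P c1 s) n2 (effect P c2 (effect P c1 s))"
      "n2 \<le> max_cost c2" using Seq by fastforce
    ultimately show ?case using exec.Seq by (fastforce intro: exI[of _ "n1 + n2"])
  next
    case (If b c1 c2)
    show ?case
    proof (cases "bval P b s")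
      case True
      obtain n where "exec P c1 s n (effect P c1 s)" "n \<le> max_cost c1" using If by auto
      then show ?thesis using exec.IfTrue[OF True] True by (intro exI[of _ "1 + bcost b + n"]) auto
    next
      case False
      obtain n where "exec P c2 s n (effect P c2 s)" "n \<le> max_cost c2" using If by auto
      then show ?thesis using exec.IfFalse[OF False] False by (intro exI[of _ "1 + bcost b + n"]) auto
    qed
  qed (auto intro: exec.Skip exec.NAssign[simplified] exec.RAssign[simplified])
  then show ?thesis using assms(2) unfolding runs_def by blast
qed

abbreviation nvar :: "string \<Rightarrow> nexp" where "nvar x \<equiv> NCell x (NLit 0)"

definition For :: "string \<Rightarrow> nexp \<Rightarrow> com \<Rightarrow> com" where
  "For x b c = Seq (NAssign x (NLit 0) (NLit 0))
     (While (NLess (nvar x) b) (Seq c (NAssign x (NLit 0) (NAdd (nvar x) (NLit 1)))))"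

lemma narr_nupd [simp]: "narr (nupd x i v s) y = (if y = x then (narr s x)(i := v) else narr s y)"
  by (simp add: nupd_def)

lemma rarr_nupd [simp]: "rarr (nupd x i v s) = rarr s"
  by (simp add: nupd_def)

lemma rarr_rupd [simp]: "rarr (rupd x i v s) y = (if y = x then (rarr s x)(i := v) else rarr s y)"
  by (simp add: rupd_def)

lemma narr_rupd [simp]: "narr (rupd x i v s) = narr s"
  by (simp add: rupd_def)

text \<open>
  The invariant is stated for the store in which the counter has already been advanced. The overhead of 10
  per round covers evaluating the counter and increasing it; the factor \<open>Suc n\<close> includes the final test.
\<close>

lemma runs_For:
  assumes init: "Inv 0 (nupd x 0 0 s)"
    and bound: "\<And>i t. i \<le> n \<Longrightarrow> narr t x 0 = i \<Longrightarrow> Inv i t \<Longrightarrow> nval b t = n"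
    and body: "\<And>i t. i < n \<Longrightarrow> narr t x 0 = i \<Longrightarrow> Inv i t \<Longrightarrow>
      runs P c t N (\<lambda>u. narr u x 0 = i \<and> Inv (Suc i) (nupd x 0 (Suc i) u))"
  shows "runs P (For x b c) s (Suc n * (N + ncost b + 10)) (Inv n)"
proof -
  let ?w = "While (NLess (nvar x) b) (Seq c (NAssign x (NLit 0) (NAdd (nvar x) (NLit 1))))"
  have loop: "runs P ?w t (m * (N + ncost b + 10) + ncost b + 4) (Inv n)"
    if "i + m = n" "narr t x 0 = i" "Inv i t" for i m t
    using that
  proof (induction m arbitrary: i t)
    case 0
    then have "\<not> bval P (NLess (nvar x) b) t" using bound[of i t] by simp
    then have "exec P ?w t (1 + bcost (NLess (nvar x) b)) t" by (rule exec.WhileFalse)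
    moreover have "1 + bcost (NLess (nvar x) b) \<le> 0 * (N + ncost b + 10) + ncost b + 4" by simp
    moreover have "Inv n t" using 0 by simp
    ultimately show ?case unfolding runs_def by blast
  next
    case (Suc m)
    then have "i < n" by simp
    obtain k u where u: "exec P c t k u" "k \<le> N" "narr u x 0 = i" "Inv (Suc i) (nupd x 0 (Suc i) u)"
      using body[OF \<open>i < n\<close> Suc.prems(2,3)] by (auto simp: runs_def)
    have "exec P (NAssign x (NLit 0) (NAdd (nvar x) (NLit 1))) u 6 (nupd x 0 (Suc i) u)"
      using exec.NAssign[of P x "NLit 0" "NAdd (nvar x) (NLit 1)" u] u(3)
      by (simp add: numeral_eq_Suc)
    note step = exec.Seq[OF u(1) this]
    have "Suc i + m = n" "narr (nupd x 0 (Suc i) u) x 0 = Suc i" using Suc.prems by auto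
    from Suc.IH[OF this u(4)] obtain r v where v: "exec P ?w (nupd x 0 (Suc i) u) r v"
      "r \<le> m * (N + ncost b + 10) + ncost b + 4" "Inv n v" by (auto simp: runs_def)
    have "bval P (NLess (nvar x) b) t" using bound[of i t] Suc.prems \<open>i < n\<close> by simp
    then have "exec P ?w t (1 + bcost (NLess (nvar x) b) + (k + 6) + r) v"
      by (rule exec.WhileTrue[OF _ step v(1)])
    moreover have "1 + bcost (NLess (nvar x) b) + (k + 6) + r
        \<le> Suc m * (N + ncost b + 10) + ncost b + 4" using u(2) v(2) by simp
    ultimately show ?case using v(3) unfolding runs_def by blast
  qed
  have "exec P (NAssign x (NLit 0) (NLit 0)) s 3 (nupd x 0 0 s)"
    using exec.NAssign[of P x "NLit 0" "NLit 0" s] by (simp add: numeral_eq_Suc)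
  then have "runs P (NAssign x (NLit 0) (NLit 0)) s 3 (\<lambda>t. t = nupd x 0 0 s)"
    unfolding runs_def by blast
  then have "runs P (For x b c) s (3 + (n * (N + ncost b + 10) + ncost b + 4)) (Inv n)"
    unfolding For_def by (rule runs_Seq) (use loop[of 0 n] init in simp)
  then show ?thesis by (rule runs_weaken) auto
qed

section \<open>The program filling the table\<close>

definition ystep_exp :: rexp where
  "ystep_exp = RDiv (Demand Period) (OfNat (nvar ''M''))"

definition latest_exp :: rexp where
  "latest_exp = RAdd Period (RMul Loading (Demand Period))"

definition dstep_exp :: rexp where
  "dstep_exp = RDiv latest_exp (OfNat (nvar ''M''))"

definition idx_exp :: "nexp \<Rightarrow> nexp \<Rightarrow> nexp \<Rightarrow> nexp" where
  "idx_exp j k l =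
     NAdd (NMul (NAdd (NMul j (NAdd (nvar ''M'') (NLit 1))) k) (NAdd (nvar ''M'') (NLit 1))) l"

definition length_exp :: rexp where
  "length_exp = RMul (OfNat (NSub (nvar ''k'') (nvar ''p''))) ystep_exp"

definition admissible_exp :: bexp where
  "admissible_exp =
     And (Not (RLess (RMul (OfNat (nvar ''j'')) Capacity) (RMul (OfNat (nvar ''p'')) ystep_exp)))
    (And (Not (RLess (RAdd Capacity ystep_exp) length_exp))
         (Not (RLess (RAdd (RMul (OfNat (nvar ''l'')) dstep_exp) (RMul Loading ystep_exp))
                     (RAdd (Taubar (RMul (OfNat (nvar ''k'')) ystep_exp)) (RMul Loading length_exp)))))"

definition candidate_exp :: rexp where
  "candidate_exp = RAdd (RCell ''A'' (idx_exp (nvar ''j'') (nvar ''p'') (nvar ''l'')))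
     (RMul (RMul (OfNat (nvar ''l'')) dstep_exp) length_exp)"

definition cell_exp :: nexp where
  "cell_exp = idx_exp (NAdd (nvar ''j'') (NLit 1)) (nvar ''k'') (nvar ''l'')"

definition previous_exp :: nexp where
  "previous_exp = idx_exp (NAdd (nvar ''j'') (NLit 1)) (nvar ''k'') (NSub (nvar ''l'') (NLit 1))"

text \<open>
  At a positive level the entry starts with the solution found at the level below, pointers included;
  in this way the minimum over all lower levels takes constant time.
\<close>

definition start_cell :: com where
  "start_cell = If (NLess (NLit 0) (nvar ''l''))
     (Seq (RAssign ''A'' cell_exp (RCell ''A'' previous_exp))
     (Seq (NAssign ''K'' cell_exp (NCell ''K'' previous_exp))
          (NAssign ''L'' cell_exp (NCell ''L'' previous_exp))))
     (RAssign ''A'' cell_exp (RAdd (RMul latest_exp (Demand Period)) (OfNat (NLit 1))))"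

definition relax_cell :: com where
  "relax_cell = If (And admissible_exp (RLess candidate_exp (RCell ''A'' cell_exp)))
     (Seq (RAssign ''A'' cell_exp candidate_exp)
     (Seq (NAssign ''K'' cell_exp (nvar ''p''))
          (NAssign ''L'' cell_exp (nvar ''l''))))
     Skip"

definition fill_cell :: com where
  "fill_cell = Seq start_cell (For ''p'' (NAdd (nvar ''k'') (NLit 1)) relax_cell)"

definition fill_row :: com where
  "fill_row = For ''l'' (NAdd (nvar ''M'') (NLit 1)) fill_cell"

definition fill_layer :: com where
  "fill_layer = For ''k'' (NAdd (nvar ''M'') (NLit 1)) fill_row"

definition fill_table :: com where
  "fill_table = For ''j'' (nvar ''S'') fill_layer"

text \<open>
  An entry only depends on smaller addresses, so it stays correct while later ones are written.
\<close>

lemma entry_ok_local: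
  assumes ok: "entry_ok P M a K L j k l m"
    and kl: "k \<le> M" "l \<le> M" "idx M (Suc j) k l < w"
    and eq: "\<And>i. i < w \<Longrightarrow> a' i = a i \<and> K' i = K i \<and> L' i = L i"
  shows "entry_ok P M a' K' L' j k l m"
proof -
  have prev: "a' (idx M j p q) = a (idx M j p q)" if "p \<le> k" "q \<le> l" for p q
    using eq[of "idx M j p q"] idx_less_next_layer[of p M q j k l] that kl by auto
  have prev': "a' (idx M j p l) = a (idx M j p l)" if "admissible P M j p k l" for p
    using prev[of p l] admissible_le[OF that] by simp
  have here: "a' (idx M (Suc j) k l) = a (idx M (Suc j) k l)"
    "K' (idx M (Suc j) k l) = K (idx M (Suc j) k l)" "L' (idx M (Suc j) k l) = L (idx M (Suc j) k l)"
    using eq kl by auto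
  have "idx M (Suc j) k (l - 1) \<le> idx M (Suc j) k l" by (simp add: idx_def)
  then have left: "a' (idx M (Suc j) k (l - 1)) = a (idx M (Suc j) k (l - 1))"
    using eq kl by (meson le_less_trans)
  show ?thesis
    using ok prev prev' admissible_le unfolding entry_ok_def Let_def here left by metis
qed

context
  fixes P :: shuttle_data and M j k l w :: nat and a :: "nat \<Rightarrow> real" and K L :: "nat \<Rightarrow> nat"
  assumes kM: "k \<le> M" and lM: "l \<le> M" and w: "w = idx M (Suc j) k l"
begin

lemma idx_prev_neq: "p \<le> k \<Longrightarrow> q \<le> M \<Longrightarrow> idx M j p q \<noteq> w"
  using idx_less_next_layer[of p M q j k l] kM by (simp add: w)

lemma entry_ok_start_unreached:
  "l = 0 \<Longrightarrow> entry_ok P M (a(w := unreached P)) K L j k l 0"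
  by (simp add: entry_ok_def w)

lemma entry_ok_start_inherit:
  assumes "0 < l" and ok: "entry_ok P M a K L j k (l - 1) (Suc k)"
  defines "v \<equiv> idx M (Suc j) k (l - 1)"
  shows "entry_ok P M (a(w := a v)) (K(w := K v)) (L(w := L v)) j k l 0"
proof -
  have vw: "v \<noteq> w" using assms(1) by (simp add: v_def w idx_def)
  have "L v \<le> l - 1 \<and> admissible P M j (K v) k (L v) \<and>
      a v = a (idx M j (K v) (L v)) + step_cost P M (K v) k (L v)" if "a v < unreached P"
    using entry_ok_predecessor[OF ok, of v] that by (simp add: v_def)
  moreover from this have "idx M j (K v) (L v) \<noteq> w" if "a v < unreached P"
    using that lM admissible_le[of P M j "K v" k "L v"] by (intro idx_prev_neq) auto
  ultimately show ?thesis using vw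
    unfolding entry_ok_def Let_def w[symmetric] v_def[symmetric] by auto
qed

lemma entry_ok_relax:
  assumes ok: "entry_ok P M a K L j k l p"
    and adm: "admissible P M j p k l"
    and less: "a (idx M j p l) + step_cost P M p k l < a w"
  shows "entry_ok P M (a(w := a (idx M j p l) + step_cost P M p k l)) (K(w := p)) (L(w := l)) j k l (Suc p)"
proof -
  have ne: "idx M j q l \<noteq> w" if "admissible P M j q k l" for q
    using admissible_le[OF that] lM by (rule idx_prev_neq)
  have vw: "0 < l \<Longrightarrow> idx M (Suc j) k (l - 1) \<noteq> w" by (simp add: w idx_def)
  show ?thesis using ok adm less ne vw
    unfolding entry_ok_def Let_def w[symmetric] by (auto simp: less_Suc_eq intro: less_imp_le order_trans)
qed

lemma entry_ok_no_relax:
  assumes ok: "entry_ok P M a K L j k l p"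
    and "admissible P M j p k l \<Longrightarrow> a w \<le> a (idx M j p l) + step_cost P M p k l"
  shows "entry_ok P M a K L j k l (Suc p)"
  using assms unfolding entry_ok_def Let_def w[symmetric] by (auto simp: less_Suc_eq)

end

text \<open>
  As \<open>idx\<close> respects the lexicographic order, the progress of all three outer loops is described by the
  single number \<open>c\<close>.
\<close>

definition filled :: "shuttle_data \<Rightarrow> nat \<Rightarrow> nat \<Rightarrow> nat \<Rightarrow> store \<Rightarrow> bool" where
  "filled P S M c s \<longleftrightarrow> narr s ''S'' 0 = S \<and> narr s ''M'' 0 = M \<and>
     (\<forall>i < idx M 1 0 0. rarr s ''A'' i = 0) \<and>
     (\<forall>j k l. k \<le> M \<longrightarrow> l \<le> M \<longrightarrow> idx M j k l < c \<longrightarrow>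
        entry_ok P M (rarr s ''A'') (narr s ''K'') (narr s ''L'') j k l (Suc k))"

text \<open>
  The entry processed at stage \<open>c\<close> is stored one layer further on, at address \<open>c + (M + 1)^2\<close>; what is
  written from there on cannot disturb what has been filled.
\<close>

lemma filled_agree:
  assumes f: "filled P S M c s"
    and eq: "narr t ''S'' 0 = narr s ''S'' 0" "narr t ''M'' 0 = narr s ''M'' 0"
      "\<And>i. i < c + Suc M * Suc M \<Longrightarrow> rarr t ''A'' i = rarr s ''A'' i \<and>
         narr t ''K'' i = narr s ''K'' i \<and> narr t ''L'' i = narr s ''L'' i"
  shows "filled P S M c t"
  unfolding filled_def
proof (intro conjI allI impI)
  show "narr t ''S'' 0 = S" "narr t ''M'' 0 = M" using f eq by (auto simp: filled_def)
  show "rarr t ''A'' i = 0" if "i < idx M 1 0 0" for i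
  proof -
    have "i < c + Suc M * Suc M" using that by (simp add: idx_def)
    then show ?thesis using eq(3)[of i] f that by (simp add: filled_def)
  qed
  fix j k l assume *: "k \<le> M" "l \<le> M" "idx M j k l < c"
  show "entry_ok P M (rarr t ''A'') (narr t ''K'') (narr t ''L'') j k l (Suc k)"
  proof (rule entry_ok_local[OF _ *(1,2)])
    show "entry_ok P M (rarr s ''A'') (narr s ''K'') (narr s ''L'') j k l (Suc k)"
      using f * by (simp add: filled_def)
    show "idx M (Suc j) k l < c + Suc M * Suc M" using *(3) by (simp add: idx_Suc_layer)
  qed (use eq(3) in auto)
qed

lemma filled_next:
  assumes "filled P S M (idx M j k l) s" "k \<le> M" "l \<le> M"
    and "entry_ok P M (rarr s ''A'') (narr s ''K'') (narr s ''L'') j k l (Suc k)"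
  shows "filled P S M (Suc (idx M j k l)) s"
  using assms idx_inject[of M _ _ _ j k l] unfolding filled_def less_Suc_eq by blast


lemma rval_ystep_exp:
  "shuttle_instance P \<Longrightarrow> narr s ''M'' 0 = M \<Longrightarrow> rval P ystep_exp s = ystep P M"
  by (simp add: ystep_exp_def ystep_def demand_op_def total_demand_def shuttle_instance_def)

lemma rval_latest_exp: "shuttle_instance P \<Longrightarrow> rval P latest_exp s = latest P"
  by (simp add: latest_exp_def latest_def demand_op_def total_demand_def shuttle_instance_def)

lemma rval_dstep_exp:
  "shuttle_instance P \<Longrightarrow> narr s ''M'' 0 = M \<Longrightarrow> rval P dstep_exp s = dstep P M"
  by (simp add: dstep_exp_def dstep_def rval_latest_exp)

lemma nval_idx_exp:
  "narr s ''M'' 0 = M \<Longrightarrow> nval (idx_exp a b c) s = idx M (nval a s) (nval b s) (nval c s)"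
  by (simp add: idx_exp_def idx_def)

definition cell_time :: "nat \<Rightarrow> nat" where
  "cell_time M = max_cost start_cell + (M + 2) * (max_cost relax_cell + 14)"

definition at_cell :: "nat \<Rightarrow> nat \<Rightarrow> nat \<Rightarrow> store \<Rightarrow> bool" where
  "at_cell j k l s \<longleftrightarrow> narr s ''j'' 0 = j \<and> narr s ''k'' 0 = k \<and> narr s ''l'' 0 = l"

definition in_progress ::
  "shuttle_data \<Rightarrow> nat \<Rightarrow> nat \<Rightarrow> nat \<Rightarrow> nat \<Rightarrow> nat \<Rightarrow> nat \<Rightarrow> store \<Rightarrow> bool" where
  "in_progress P S M j k l p s \<longleftrightarrow> filled P S M (idx M j k l) s \<and> at_cell j k l s \<and>
     entry_ok P M (rarr s ''A'') (narr s ''K'') (narr s ''L'') j k l p"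

context
  fixes P :: shuttle_data and S M j k l :: nat
  assumes inst: "shuttle_instance P" and M: "0 < M" and kM: "k \<le> M" and lM: "l \<le> M"
begin

lemma in_progress_write:
  assumes "filled P S M (idx M j k l) s" "at_cell j k l s"
    and "w = idx M (Suc j) k l"
    and "\<And>x. x \<noteq> ''K'' \<Longrightarrow> x \<noteq> ''L'' \<Longrightarrow> narr t x = narr s x"
    and "rarr t ''A'' = (rarr s ''A'')(w := va)"
    and "narr t ''K'' = (narr s ''K'')(w := vk)" "narr t ''L'' = (narr s ''L'')(w := vl)"
    and "entry_ok P M ((rarr s ''A'')(w := va)) ((narr s ''K'')(w := vk)) ((narr s ''L'')(w := vl)) j k l p"
  shows "in_progress P S M j k l p t"
proof -
  have "filled P S M (idx M j k l) t"
    by (rule filled_agree[OF assms(1)])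
      (use assms(3) in \<open>auto simp: assms(4-7) idx_Suc_layer\<close>)
  then show ?thesis using assms by (simp add: in_progress_def at_cell_def)
qed

lemma start_cell_runs:
  assumes "filled P S M (idx M j k l) s" "at_cell j k l s"
  shows "runs P start_cell s (max_cost start_cell) (in_progress P S M j k l 0)"
proof (rule runs_loopfree)
  show "loopfree start_cell" by (simp add: start_cell_def)
  have MM: "narr s ''M'' 0 = M" and vars: "narr s ''j'' 0 = j" "narr s ''k'' 0 = k" "narr s ''l'' 0 = l"
    using assms by (auto simp: filled_def at_cell_def)
  define w where "w = idx M (Suc j) k l"
  define v where "v = idx M (Suc j) k (l - 1)"
  have cells: "nval cell_exp t = w" "nval previous_exp t = v"
    if "narr t ''M'' 0 = M" "narr t ''j'' 0 = j" "narr t ''k'' 0 = k" "narr t ''l'' 0 = l" for t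
    using that by (auto simp: cell_exp_def previous_exp_def nval_idx_exp w_def v_def)
  show "in_progress P S M j k l 0 (effect P start_cell s)"
  proof (cases "l = 0")
    case True
    then have eff: "effect P start_cell s = rupd ''A'' w (unreached P) s"
      using inst by (simp add: start_cell_def cells MM vars rval_latest_exp unreached_def
          demand_op_def total_demand_def shuttle_instance_def)
    show ?thesis
      by (rule in_progress_write[OF assms w_def, where va = "unreached P"
            and vk = "narr s ''K'' w" and vl = "narr s ''L'' w"])
        (simp_all add: eff entry_ok_start_unreached[OF kM lM w_def True])
  next
    case False
    then have eff: "effect P start_cell s =
        nupd ''L'' w (narr s ''L'' v) (nupd ''K'' w (narr s ''K'' v) (rupd ''A'' w (rarr s ''A'' v) s))"
      by (simp add: start_cell_def cells MM vars)
    have "idx M j k (l - 1) < idx M j k l" using False by (simp add: idx_def)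
    then have "entry_ok P M (rarr s ''A'') (narr s ''K'') (narr s ''L'') j k (l - 1) (Suc k)"
      using assms(1) kM lM by (simp add: filled_def)
    from entry_ok_start_inherit[OF kM lM w_def _ this] False
    have ok: "entry_ok P M ((rarr s ''A'')(w := rarr s ''A'' v)) ((narr s ''K'')(w := narr s ''K'' v))
        ((narr s ''L'')(w := narr s ''L'' v)) j k l 0" by (simp add: v_def)
    show ?thesis by (rule in_progress_write[OF assms w_def _ _ _ _ ok]) (simp_all add: eff)
  qed
qed

lemma relax_cell_runs:
  assumes prog: "in_progress P S M j k l p s" and pk: "p \<le> k" and p: "narr s ''p'' 0 = p"
  shows "runs P relax_cell s (max_cost relax_cell) (\<lambda>t. narr t ''p'' 0 = p \<and> in_progress P S M j k l (Suc p) t)"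
proof (rule runs_loopfree)
  show "loopfree relax_cell" by (simp add: relax_cell_def)
  have fil: "filled P S M (idx M j k l) s" and cell: "at_cell j k l s"
    and ok: "entry_ok P M (rarr s ''A'') (narr s ''K'') (narr s ''L'') j k l p"
    using prog by (auto simp: in_progress_def)
  have MM: "narr s ''M'' 0 = M" and vars: "narr s ''j'' 0 = j" "narr s ''k'' 0 = k" "narr s ''l'' 0 = l"
    using fil cell by (auto simp: filled_def at_cell_def)
  define w where "w = idx M (Suc j) k l"
  have w: "nval cell_exp t = w"
    if "narr t ''M'' 0 = M" "narr t ''j'' 0 = j" "narr t ''k'' 0 = k" "narr t ''l'' 0 = l" for t
    using that by (auto simp: cell_exp_def nval_idx_exp w_def)
  have "real k * ystep P M \<in> {0..total_demand P}"
    using grid_le_total[OF inst M kM] ystep_pos[OF inst M] by simp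
  then have adm: "bval P admissible_exp s \<longleftrightarrow> admissible P M j p k l"
    using pk by (simp add: admissible_exp_def length_exp_def rval_ystep_exp[OF inst MM]
        rval_dstep_exp[OF inst MM] vars p admissible_def taubar_op_def not_less)
  define c where "c = rarr s ''A'' (idx M j p l) + step_cost P M p k l"
  have cand: "rval P candidate_exp s = c"
    by (simp add: candidate_exp_def length_exp_def rval_ystep_exp[OF inst MM]
        rval_dstep_exp[OF inst MM] nval_idx_exp[OF MM] vars p c_def step_cost_def)
  show "narr (effect P relax_cell s) ''p'' 0 = p \<and> in_progress P S M j k l (Suc p) (effect P relax_cell s)"
  proof (cases "admissible P M j p k l \<and> c < rarr s ''A'' w")
    case True
    then have eff: "effect P relax_cell s = nupd ''L'' w l (nupd ''K'' w p (rupd ''A'' w c s))"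
      by (simp add: relax_cell_def adm cand w MM vars p)
    have "entry_ok P M ((rarr s ''A'')(w := c)) ((narr s ''K'')(w := p)) ((narr s ''L'')(w := l)) j k l (Suc p)"
      unfolding c_def by (rule entry_ok_relax[OF kM lM w_def ok]) (use True in \<open>auto simp: c_def\<close>)
    then have "in_progress P S M j k l (Suc p) (effect P relax_cell s)"
      by (rule in_progress_write[OF fil cell w_def, rotated -1]) (simp_all add: eff)
    then show ?thesis by (simp add: eff p)
  next
    case False
    then have eff: "effect P relax_cell s = s"
      by (auto simp: relax_cell_def adm cand w MM vars)
    have "entry_ok P M (rarr s ''A'') (narr s ''K'') (narr s ''L'') j k l (Suc p)"
      by (rule entry_ok_no_relax[OF kM lM w_def ok]) (use False in \<open>auto simp: c_def\<close>)
    then show ?thesis using prog by (simp add: eff p in_progress_def)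
  qed
qed

text \<open>
  The inner loop stops at \<open>p = k\<close>, since no admissible step decreases the load.
\<close>

lemma fill_cell_runs:
  assumes "filled P S M (idx M j k l) s" "at_cell j k l s"
  shows "runs P fill_cell s (cell_time M)
    (\<lambda>t. at_cell j k l t \<and> filled P S M (Suc (idx M j k l)) t)"
  unfolding fill_cell_def cell_time_def
proof (rule runs_Seq[OF start_cell_runs[OF assms]])
  have scalar: "in_progress P S M j k l p (nupd ''p'' 0 v t) = in_progress P S M j k l p t" for p v t
    by (simp add: in_progress_def filled_def at_cell_def)
  fix t assume t: "in_progress P S M j k l 0 t"
  have "runs P (For ''p'' (NAdd (nvar ''k'') (NLit 1)) relax_cell) t
     (Suc (Suc k) * (max_cost relax_cell + ncost (NAdd (nvar ''k'') (NLit 1)) + 10)) (in_progress P S M j k l (Suc k))"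
  proof (rule runs_For)
    show "in_progress P S M j k l 0 (nupd ''p'' 0 0 t)" using t by (simp add: scalar)
    show "nval (NAdd (nvar ''k'') (NLit 1)) u = Suc k" if "in_progress P S M j k l p u" for p u
      using that by (simp add: in_progress_def at_cell_def)
    fix p u assume "p < Suc k" "narr u ''p'' 0 = p" "in_progress P S M j k l p u"
    then show "runs P relax_cell u (max_cost relax_cell)
        (\<lambda>v. narr v ''p'' 0 = p \<and> in_progress P S M j k l (Suc p) (nupd ''p'' 0 (Suc p) v))"
      using relax_cell_runs[of p u] by (simp add: scalar)
  qed
  then show "runs P (For ''p'' (NAdd (nvar ''k'') (NLit 1)) relax_cell) t
      ((M + 2) * (max_cost relax_cell + 14))
      (\<lambda>t. at_cell j k l t \<and> filled P S M (Suc (idx M j k l)) t)"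
  proof (rule runs_weaken)
    show "Suc (Suc k) * (max_cost relax_cell + ncost (NAdd (nvar ''k'') (NLit 1)) + 10)
        \<le> (M + 2) * (max_cost relax_cell + 14)" using kM by (intro mult_le_mono) auto
  qed (use filled_next[OF _ kM lM] in \<open>auto simp: in_progress_def\<close>)
qed

end

definition row_time :: "nat \<Rightarrow> nat" where "row_time M = (M + 2) * (cell_time M + 14)"
definition layer_time :: "nat \<Rightarrow> nat" where "layer_time M = (M + 2) * (row_time M + 14)"
definition table_time :: "nat \<Rightarrow> nat \<Rightarrow> nat" where "table_time S M = (S + 1) * (layer_time M + 12)"

lemma filled_scalar:
  "x \<notin> {''S'', ''M'', ''K'', ''L''} \<Longrightarrow> filled P S M c (nupd x i v s) = filled P S M c s"
  by (auto simp: filled_def)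

lemma filled_bounds:
  assumes "filled P S M c s"
  shows "narr s ''S'' 0 = S" "narr s ''M'' 0 = M"
  using assms by (auto simp: filled_def)

lemma fill_row_runs:
  assumes inst: "shuttle_instance P" and M: "0 < M" and kM: "k \<le> M"
    and s: "filled P S M (idx M j k 0) s" "narr s ''j'' 0 = j" "narr s ''k'' 0 = k"
  shows "runs P fill_row s (row_time M)
    (\<lambda>t. filled P S M (idx M j (Suc k) 0) t \<and> narr t ''j'' 0 = j \<and> narr t ''k'' 0 = k)"
proof -
  have "runs P fill_row s
     (Suc (Suc M) * (cell_time M + ncost (NAdd (nvar ''M'') (NLit 1)) + 10))
     (\<lambda>t. filled P S M (idx M j k (Suc M)) t \<and> narr t ''j'' 0 = j \<and> narr t ''k'' 0 = k)"
    unfolding fill_row_def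
  proof (rule runs_For[where Inv = "\<lambda>l t. filled P S M (idx M j k l) t \<and> narr t ''j'' 0 = j \<and> narr t ''k'' 0 = k"])
    fix l t
    assume "l < Suc M" "narr t ''l'' 0 = l"
      and t: "filled P S M (idx M j k l) t \<and> narr t ''j'' 0 = j \<and> narr t ''k'' 0 = k"
    then have "runs P fill_cell t (cell_time M)
        (\<lambda>t. at_cell j k l t \<and> filled P S M (Suc (idx M j k l)) t)"
      using inst M kM by (intro fill_cell_runs) (auto simp: at_cell_def)
    then show "runs P fill_cell t (cell_time M) (\<lambda>u. narr u ''l'' 0 = l \<and>
        filled P S M (idx M j k (Suc l)) (nupd ''l'' 0 (Suc l) u) \<and>
        narr (nupd ''l'' 0 (Suc l) u) ''j'' 0 = j \<and> narr (nupd ''l'' 0 (Suc l) u) ''k'' 0 = k)"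
      by (rule runs_weaken) (auto simp: at_cell_def filled_scalar idx_def)
  qed (use s in \<open>auto simp: filled_scalar dest: filled_bounds\<close>)
  then show ?thesis
    by (rule runs_weaken) (auto simp: row_time_def idx_row_end)
qed

lemma fill_layer_runs:
  assumes inst: "shuttle_instance P" and M: "0 < M"
    and s: "filled P S M (idx M j 0 0) s" "narr s ''j'' 0 = j"
  shows "runs P fill_layer s (layer_time M)
    (\<lambda>t. filled P S M (idx M (Suc j) 0 0) t \<and> narr t ''j'' 0 = j)"
proof -
  have "runs P fill_layer s
     (Suc (Suc M) * (row_time M + ncost (NAdd (nvar ''M'') (NLit 1)) + 10))
     (\<lambda>t. filled P S M (idx M j (Suc M) 0) t \<and> narr t ''j'' 0 = j)"
    unfolding fill_layer_def
  proof (rule runs_For[where Inv = "\<lambda>k t. filled P S M (idx M j k 0) t \<and> narr t ''j'' 0 = j"])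
    fix k t
    assume "k < Suc M" "narr t ''k'' 0 = k" and t: "filled P S M (idx M j k 0) t \<and> narr t ''j'' 0 = j"
    then have "runs P fill_row t (row_time M)
        (\<lambda>t. filled P S M (idx M j (Suc k) 0) t \<and> narr t ''j'' 0 = j \<and> narr t ''k'' 0 = k)"
      using inst M by (intro fill_row_runs) auto
    then show "runs P fill_row t (row_time M) (\<lambda>u. narr u ''k'' 0 = k \<and>
        filled P S M (idx M j (Suc k) 0) (nupd ''k'' 0 (Suc k) u) \<and>
        narr (nupd ''k'' 0 (Suc k) u) ''j'' 0 = j)"
      by (rule runs_weaken) (auto simp: filled_scalar)
  qed (use s in \<open>auto simp: filled_scalar dest: filled_bounds\<close>)
  then show ?thesis
    by (rule runs_weaken) (auto simp: layer_time_def idx_layer_end)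
qed

lemma fill_table_runs:
  assumes inst: "shuttle_instance P" and M: "0 < M"
  shows "runs P fill_table (input_store S M) (table_time S M) (filled P S M (idx M S 0 0))"
proof -
  have "runs P fill_table (input_store S M) (Suc S * (layer_time M + ncost (nvar ''S'') + 10))
     (filled P S M (idx M S 0 0))"
    unfolding fill_table_def
  proof (rule runs_For[where Inv = "\<lambda>j. filled P S M (idx M j 0 0)"])
    show "filled P S M (idx M 0 0 0) (nupd ''j'' 0 0 (input_store S M))"
      by (simp add: filled_scalar) (simp add: filled_def input_store_def idx_def)
    fix j t assume "j < S" "narr t ''j'' 0 = j" "filled P S M (idx M j 0 0) t"
    then have "runs P fill_layer t (layer_time M)
        (\<lambda>t. filled P S M (idx M (Suc j) 0 0) t \<and> narr t ''j'' 0 = j)"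
      using inst M by (intro fill_layer_runs) auto
    then show "runs P fill_layer t (layer_time M) (\<lambda>u. narr u ''j'' 0 = j \<and>
        filled P S M (idx M (Suc j) 0 0) (nupd ''j'' 0 (Suc j) u))"
      by (rule runs_weaken) (auto simp: filled_scalar)
  qed (auto dest: filled_bounds)
  then show ?thesis by (rule runs_weaken) (auto simp: table_time_def)
qed

lemma filled_table_ok:
  assumes "filled P S M (idx M S 0 0) s"
  shows "table_ok P S M (rarr s ''A'') (narr s ''K'') (narr s ''L'')"
  unfolding table_ok_def
proof (intro conjI allI impI)
  show "rarr s ''A'' i = 0" if "i < idx M 1 0 0" for i using assms that by (simp add: filled_def)
  fix j k l assume *: "j < S" "k \<le> M" "l \<le> M"
  have "idx M j k l < idx M (Suc j) 0 0" using * by (intro idx_less_next_layer)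
  also have "\<dots> \<le> idx M S 0 0" using * unfolding idx_def by (simp del: mult_Suc mult_Suc_right) 
  finally show "entry_ok P M (rarr s ''A'') (narr s ''K'') (narr s ''L'') j k l (Suc k)"
    using assms * by (simp add: filled_def)
qed

section \<open>The program extracting a solution\<close>

definition current_exp :: nexp where
  "current_exp = NSub (nvar ''S'') (nvar ''i'')"

definition grid_value_exp :: rexp where
  "grid_value_exp = RMul (OfNat (nvar ''k'')) ystep_exp"

definition pushed_value_exp :: rexp where
  "pushed_value_exp = RSub (RCell ''y'' current_exp) Capacity"

definition walk_start :: com where
  "walk_start = Seq (NAssign ''k'' (NLit 0) (nvar ''M''))
    (Seq (NAssign ''l'' (NLit 0) (nvar ''M''))
         (RAssign ''y'' (nvar ''S'') (Demand Period)))"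

text \<open>
  The scalar \<open>p\<close> keeps the new load until the old one has been used a second time for the address of
  the level pointer.
\<close>

definition walk_step :: com where
  "walk_step =
     Seq (NAssign ''p'' (NLit 0) (NCell ''K'' (idx_exp current_exp (nvar ''k'') (nvar ''l''))))
    (Seq (NAssign ''l'' (NLit 0) (NCell ''L'' (idx_exp current_exp (nvar ''k'') (nvar ''l''))))
    (Seq (NAssign ''k'' (NLit 0) (nvar ''p''))
    (If (RLess grid_value_exp pushed_value_exp)
       (RAssign ''y'' (NSub current_exp (NLit 1)) pushed_value_exp)
       (RAssign ''y'' (NSub current_exp (NLit 1)) grid_value_exp))))"

definition walk_back :: com where
  "walk_back = Seq walk_start (For ''i'' (nvar ''S'') walk_step)"

definition next_exp :: nexp where
  "next_exp = NAdd (nvar ''i'') (NLit 1)"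

definition load_end_exp :: rexp where
  "load_end_exp = RAdd (Taubar (RCell ''y'' next_exp))
     (RMul Loading (RSub (RCell ''y'' next_exp) (RCell ''y'' (nvar ''i''))))"

definition departures_start :: com where
  "departures_start = RAssign ''d'' (NLit 0) (OfNat (NLit 0))"

definition departures_step :: com where
  "departures_step = If (RLess (RCell ''d'' (nvar ''i'')) load_end_exp)
     (RAssign ''d'' next_exp load_end_exp)
     (RAssign ''d'' next_exp (RCell ''d'' (nvar ''i'')))"

definition set_departures :: com where
  "set_departures = Seq departures_start (For ''i'' (nvar ''S'') departures_step)"

definition shuttle_program :: com where
  "shuttle_program = Seq fill_table (Seq walk_back set_departures)"

text \<open>
  After \<open>i\<close> steps the scalars hold the backtracked state, and the repaired loads are known from shuttle
  \<open>S - i\<close> on.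
\<close>

definition walked :: "shuttle_data \<Rightarrow> nat \<Rightarrow> nat \<Rightarrow> (nat \<Rightarrow> nat) \<Rightarrow> (nat \<Rightarrow> nat) \<Rightarrow> nat \<Rightarrow> store \<Rightarrow> bool" where
  "walked P S M K L i s \<longleftrightarrow>
     narr s ''S'' 0 = S \<and> narr s ''M'' 0 = M \<and> narr s ''K'' = K \<and> narr s ''L'' = L \<and>
     (narr s ''k'' 0, narr s ''l'' 0) = backtrack S M K L i \<and>
     rarr s ''y'' S = total_demand P \<and>
     (\<forall>j<S. S - i \<le> j \<longrightarrow> rarr s ''y'' j =
        max (real (fst (backtrack S M K L (S - j))) * ystep P M) (rarr s ''y'' (Suc j) - capacity P))"

definition walk_time :: "nat \<Rightarrow> nat" where
  "walk_time S = max_cost walk_start + (S + 1) * (max_cost walk_step + 12)"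

lemma walk_step_effect:
  assumes inst: "shuttle_instance P" and i: "i < S" "narr s ''i'' 0 = i"
    and walked: "walked P S M K L i s"
  shows "walked P S M K L (Suc i) (nupd ''i'' 0 (Suc i) (effect P walk_step s)) \<and>
    narr (effect P walk_step s) ''i'' 0 = i"
proof -
  define y where "y = rarr s ''y''"
  have MM: "narr s ''M'' 0 = M" and SS: "narr s ''S'' 0 = S"
    and KL: "narr s ''K'' = K" "narr s ''L'' = L"
    and kl: "narr s ''k'' 0 = fst (backtrack S M K L i)" "narr s ''l'' 0 = snd (backtrack S M K L i)"
    and yS: "y S = total_demand P"
    and y: "\<And>j. j < S \<Longrightarrow> S - i \<le> j \<Longrightarrow> y j =
        max (real (fst (backtrack S M K L (S - j))) * ystep P M) (y (Suc j) - capacity P)"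
    using walked unfolding walked_def y_def by (auto simp: prod_eq_iff)
  define k' where "k' = fst (backtrack S M K L (Suc i))"
  define l' where "l' = snd (backtrack S M K L (Suc i))"
  define v where "v = max (real k' * ystep P M) (y (S - i) - capacity P)"
  have cur: "nval current_exp t = S - i" if "narr t ''S'' 0 = S" "narr t ''i'' 0 = i" for t
    using that by (simp add: current_exp_def)
  have "effect P walk_step s =
      rupd ''y'' (S - Suc i) v (nupd ''k'' 0 k' (nupd ''l'' 0 l' (nupd ''p'' 0 k' s)))"
    by (simp add: walk_step_def nval_idx_exp[of _ M] MM SS KL kl i cur rval_ystep_exp[OF inst, of _ M]
        grid_value_exp_def pushed_value_exp_def v_def k'_def l'_def y_def Let_def max_def)
  then have eff: "nupd ''i'' 0 (Suc i) (effect P walk_step s) = nupd ''i'' 0 (Suc i)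
      (rupd ''y'' (S - Suc i) v (nupd ''k'' 0 k' (nupd ''l'' 0 l' (nupd ''p'' 0 k' s))))"
    "narr (effect P walk_step s) ''i'' 0 = i" using i by simp_all
  have new: "(y(S - Suc i := v)) j =
      max (real (fst (backtrack S M K L (S - j))) * ystep P M) ((y(S - Suc i := v)) (Suc j) - capacity P)"
    if "j < S" "S - Suc i \<le> j" for j
  proof (cases "j = S - Suc i")
    case True
    then have "Suc j = S - i" "S - j = Suc i" using i by auto
    then show ?thesis using True by (simp add: v_def k'_def del: backtrack.simps)
  next
    case False
    then have "S - i \<le> j" using that by simp
    then show ?thesis using False y[OF that(1)] that i by simp
  qed
  have "S - Suc i \<noteq> S" using i by simp
  then have "walked P S M K L (Suc i) (nupd ''i'' 0 (Suc i) (effect P walk_step s))"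
    unfolding eff walked_def using new yS
    by (simp add: MM SS KL k'_def l'_def y_def[symmetric] del: backtrack.simps fun_upd_apply)
      (simp add: prod_eq_iff)
  then show ?thesis using eff(2) by blast
qed

lemma walk_back_runs:
  assumes inst: "shuttle_instance P" and SM: "narr s ''S'' 0 = S" "narr s ''M'' 0 = M"
    and K: "K = narr s ''K''" and L: "L = narr s ''L''"
  shows "runs P walk_back s (walk_time S) (\<lambda>t. narr t ''S'' 0 = S \<and>
    repairs P S M (\<lambda>j. fst (backtrack S M K L (S - j))) (rarr t ''y''))"
  unfolding walk_back_def walk_time_def
proof (rule runs_Seq)
  show "runs P walk_start s (max_cost walk_start) (walked P S M K L 0)"
    by (rule runs_loopfree)
      (use inst in \<open>simp_all add: walk_start_def walked_def SM K L demand_op_def total_demand_def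
        shuttle_instance_def\<close>)
  fix t assume t: "walked P S M K L 0 t"
  have scalar: "walked P S M K L i (nupd ''i'' 0 v t) = walked P S M K L i t" for i v t
    by (simp add: walked_def)
  have "runs P (For ''i'' (nvar ''S'') walk_step) t
      (Suc S * (max_cost walk_step + ncost (nvar ''S'') + 10)) (walked P S M K L S)"
  proof (rule runs_For[where Inv = "walked P S M K L"])
    fix i t assume *: "i < S" "narr t ''i'' 0 = i" "walked P S M K L i t"
    show "runs P walk_step t (max_cost walk_step)
        (\<lambda>u. narr u ''i'' 0 = i \<and> walked P S M K L (Suc i) (nupd ''i'' 0 (Suc i) u))"
      by (rule runs_loopfree) (use walk_step_effect[OF inst *] in \<open>simp_all add: walk_step_def\<close>)
  qed (use t in \<open>auto simp: scalar, simp add: walked_def\<close>)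
  then show "runs P (For ''i'' (nvar ''S'') walk_step) t ((S + 1) * (max_cost walk_step + 12))
      (\<lambda>t. narr t ''S'' 0 = S \<and> repairs P S M (\<lambda>j. fst (backtrack S M K L (S - j))) (rarr t ''y''))"
    by (rule runs_weaken) (simp_all add: walked_def repairs_def)
qed

definition departures_time :: "nat \<Rightarrow> nat" where
  "departures_time S = max_cost departures_start + (S + 1) * (max_cost departures_step + 12)"

text \<open>
  The repaired loads must lie in the domain of \<open>taubar\<close>, outside of which the machine primitive
  returns 0.
\<close>

lemma set_departures_runs:
  assumes SS: "narr s ''S'' 0 = S" and z: "z = rarr s ''y''"
    and zb: "\<And>j. j < S \<Longrightarrow> z (Suc j) \<in> {0..total_demand P}"
  shows "runs P set_departures s (departures_time S)
    (\<lambda>t. rarr t ''y'' = z \<and> earliest_departures P S z (rarr t ''d''))"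
  unfolding set_departures_def departures_time_def
proof (rule runs_Seq)
  define inv where "inv i t \<longleftrightarrow> narr t ''S'' 0 = S \<and> rarr t ''y'' = z \<and>
    earliest_departures P i z (rarr t ''d'')" for i and t :: store
  show "runs P departures_start s (max_cost departures_start) (inv 0)"
    by (rule runs_loopfree) (simp_all add: departures_start_def inv_def SS z earliest_departures_def)
  fix t assume t: "inv 0 t"
  have scalar: "inv i (nupd ''i'' 0 v t) = inv i t" for i v t by (simp add: inv_def)
  have "runs P (For ''i'' (nvar ''S'') departures_step) t
      (Suc S * (max_cost departures_step + ncost (nvar ''S'') + 10)) (inv S)"
  proof (rule runs_For[where Inv = inv])
    fix i t assume i: "i < S" "narr t ''i'' 0 = i" and t: "inv i t"
    show "runs P departures_step t (max_cost departures_step)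
        (\<lambda>u. narr u ''i'' 0 = i \<and> inv (Suc i) (nupd ''i'' 0 (Suc i) u))"
    proof (rule runs_loopfree)
      show "loopfree departures_step" by (simp add: departures_step_def)
      have y: "rarr t ''y'' = z" using t by (simp add: inv_def)
      have "effect P departures_step t = rupd ''d'' (Suc i)
          (max (rarr t ''d'' i) (taubar P (z (Suc i)) + loading P * (z (Suc i) - z i))) t"
        using zb[OF i(1)] i
        by (simp add: departures_step_def load_end_exp_def next_exp_def y taubar_op_def max_def)
      then show "narr (effect P departures_step t) ''i'' 0 = i \<and>
          inv (Suc i) (nupd ''i'' 0 (Suc i) (effect P departures_step t))"
        using t i by (auto simp: inv_def earliest_departures_def less_Suc_eq)
    qed
  qed (use t in \<open>auto simp: scalar, simp add: inv_def\<close>)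
  then show "runs P (For ''i'' (nvar ''S'') departures_step) t ((S + 1) * (max_cost departures_step + 12))
      (\<lambda>t. rarr t ''y'' = z \<and> earliest_departures P S z (rarr t ''d''))"
    by (rule runs_weaken) (simp_all add: inv_def)
qed

definition total_time :: "nat \<Rightarrow> nat \<Rightarrow> nat" where
  "total_time S M = table_time S M + (walk_time S + departures_time S)"

lemma shuttle_program_runs:
  assumes inst: "shuttle_instance P" and lip: "taubar_slope_bound P \<Lambda>" and M: "0 < M" and S: "0 < S"
    and feas: "\<exists>d y. feasible P S d y"
  shows "runs P shuttle_program (input_store S M) (total_time S M) (\<lambda>s.
    feasible P S (rarr s ''d'') (rarr s ''y'') \<and>
    g_ave P S (rarr s ''d'') (rarr s ''y'') \<le>
      OPT P S + error_constant P \<Lambda> * (real S ^ 2 / real M))"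
  unfolding shuttle_program_def total_time_def
proof (rule runs_Seq[OF fill_table_runs[OF inst M]])
  fix s assume s: "filled P S M (idx M S 0 0) s"
  let ?k = "\<lambda>j. fst (backtrack S M (narr s ''K'') (narr s ''L'') (S - j))"
  note tab = filled_table_ok[OF s]
  obtain d0 y0 where f0: "feasible P S d0 y0" using feas by blast
  note plan = backtracked_grid_plan_of_feasible(1)[OF inst M S f0 tab]
  note cap = feasible_total_capacity[OF f0]
  show "runs P (Seq walk_back set_departures) s (walk_time S + departures_time S) (\<lambda>s.
      feasible P S (rarr s ''d'') (rarr s ''y'') \<and>
      g_ave P S (rarr s ''d'') (rarr s ''y'') \<le>
        OPT P S + error_constant P \<Lambda> * (real S ^ 2 / real M))"
  proof (rule runs_Seq[OF walk_back_runs[OF inst filled_bounds[OF s] refl refl]])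
    fix t :: store assume t: "narr t ''S'' 0 = S \<and> repairs P S M ?k (rarr t ''y'')"
    then have rep: "repairs P S M ?k (rarr t ''y'')" by simp
    have "rarr t ''y'' (Suc j) \<in> {0..total_demand P}" if "j < S" for j
      using repair_nonneg[OF inst M plan cap rep, of "Suc j"]
        repair_bounds(4)[OF inst M plan cap rep, of "Suc j"] that by simp
    with t have "runs P set_departures t (departures_time S) (\<lambda>u. rarr u ''y'' = rarr t ''y'' \<and>
        earliest_departures P S (rarr t ''y'') (rarr u ''d''))"
      by (intro set_departures_runs) auto
    then show "runs P set_departures t (departures_time S) (\<lambda>s.
        feasible P S (rarr s ''d'') (rarr s ''y'') \<and>
        g_ave P S (rarr s ''d'') (rarr s ''y'') \<le>
          OPT P S + error_constant P \<Lambda> * (real S ^ 2 / real M))"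
      by (rule runs_weaken)
        (use backtracked_solution_near_optimal[OF inst lip M S feas tab rep] in auto)
  qed
qed

text \<open>
  The constants are existentially quantified, so that the costs of the program texts never have to be
  evaluated.
\<close>

lemma loop_time_bound:
  fixes f :: "nat \<Rightarrow> nat"
  assumes "\<exists>c. \<forall>M>0. f M \<le> c * M ^ n"
  shows "\<exists>c. \<forall>M>0. (M + 2) * (f M + b) \<le> c * M ^ Suc n"
proof -
  obtain c where c: "\<And>M. M > 0 \<Longrightarrow> f M \<le> c * M ^ n" using assms by blast
  have "(M + 2) * (f M + b) \<le> 3 * (c + b) * M ^ Suc n" if M: "M > 0" for M
  proof -
    have "b \<le> b * M ^ n" using M by simp
    then have "f M + b \<le> (c + b) * M ^ n" using add_mono[OF c[OF M]] by (simp only: distrib_right)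
    moreover have "M + 2 \<le> 3 * M" using M by simp
    ultimately have "(M + 2) * (f M + b) \<le> (3 * M) * ((c + b) * M ^ n)" by (rule mult_le_mono[rotated])
    then show ?thesis by (simp add: algebra_simps)
  qed
  then show ?thesis by blast
qed

lemma total_time_bound: "\<exists>c. \<forall>S M. 0 < S \<longrightarrow> 0 < M \<longrightarrow> total_time S M \<le> c * (S * M ^ 3)"
proof -
  have "\<exists>c. \<forall>M>0. (\<lambda>_. max_cost relax_cell) M \<le> c * M ^ 0" by auto
  from loop_time_bound[OF this, of 14]
  obtain c1 where c1: "\<And>M. M > 0 \<Longrightarrow> (M + 2) * (max_cost relax_cell + 14) \<le> c1 * M" by auto
  have "cell_time M \<le> (max_cost start_cell + c1) * M ^ 1" if "M > 0" for M
  proof -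
    have "max_cost start_cell \<le> max_cost start_cell * M" using that by simp
    then show ?thesis
      using add_mono[OF _ c1[OF that]] by (simp only: cell_time_def distrib_right power_one_right)
  qed
  then have "\<exists>c. \<forall>M>0. cell_time M \<le> c * M ^ 1" by blast
  from loop_time_bound[OF this, of 14]
  have "\<exists>c. \<forall>M>0. row_time M \<le> c * M ^ Suc 1" unfolding row_time_def .
  from loop_time_bound[OF this, of 14]
  obtain c2 where c2: "\<And>M. M > 0 \<Longrightarrow> layer_time M \<le> c2 * M ^ 3"
    by (auto simp: layer_time_def numeral_3_eq_3)
  let ?e = "max_cost walk_start + 2 * (max_cost walk_step + 12) +
    (max_cost departures_start + 2 * (max_cost departures_step + 12))"
  have "total_time S M \<le> (2 * (c2 + 12) + ?e) * (S * M ^ 3)" if SM: "0 < S" "0 < M" for S M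
  proof -
    have S2: "S + 1 \<le> 2 * S" and M1: "1 \<le> M ^ 3" using SM by auto
    have "layer_time M + 12 \<le> (c2 + 12) * M ^ 3" 
      using add_mono[OF c2[OF SM(2)], of 12 "12 * M ^ 3"] M1 by (simp add: distrib_right)
    then have 1: "table_time S M \<le> (2 * S) * ((c2 + 12) * M ^ 3)"
      unfolding table_time_def using S2 by (rule mult_le_mono[rotated])
    have aff: "u + (S + 1) * v \<le> (u + 2 * v) * S" for u v
    proof -
      have "u \<le> u * S" using SM by simp
      moreover have "(S + 1) * v \<le> (2 * S) * v" using S2 by (rule mult_le_mono1)
      ultimately have "u + (S + 1) * v \<le> u * S + (2 * S) * v" by (rule add_mono)
      also have "u * S + (2 * S) * v = (u + 2 * v) * S" by (simp add: algebra_simps)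
      finally show ?thesis .
    qed
    have "walk_time S + departures_time S \<le> ?e * S"
      unfolding walk_time_def departures_time_def using add_mono[OF aff aff]
      by (simp only: distrib_right)
    also have "\<dots> \<le> ?e * (S * M ^ 3)" using M1 by simp
    finally have "total_time S M \<le> (2 * S) * ((c2 + 12) * M ^ 3) + ?e * (S * M ^ 3)"
      unfolding total_time_def by (rule add_mono[OF 1])
    moreover have "(2 * S) * (x * m) + e * (S * m) = (2 * x + e) * (S * m)" for x m e
      by (simp add: algebra_simps)
    ultimately show ?thesis by (simp only:)
  qed
  then show ?thesis by blast
qed

theorem theorem2:
  shows "\<exists>prog :: com. \<forall>P :: shuttle_data.
    shuttle_instance P \<and>
    (\<forall>t\<in>{0..<period P}. demand P differentiable (at_right t)) \<and>
    0 < (INF t\<in>{0..<period P}. vector_derivative (demand P) (at_right t)) \<longrightarrow>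
    (\<exists>K L :: real. \<forall>S M :: nat. 0 < S \<and> 0 < M \<and> (\<exists>d y. feasible P S d y) \<longrightarrow>
      (\<exists>n s. exec P prog (input_store S M) n s \<and>
        real n \<le> K * (real S * real M ^ 3) \<and>
        feasible P S (rarr s ''d'') (rarr s ''y'') \<and>
        g_ave P S (rarr s ''d'') (rarr s ''y'') \<le> OPT P S + L * (real S ^ 2 / real M)))"
proof (intro exI[of _ shuttle_program] allI impI)
  fix P :: shuttle_data
  assume P: "shuttle_instance P \<and>
    (\<forall>t\<in>{0..<period P}. demand P differentiable (at_right t)) \<and>
    0 < (INF t\<in>{0..<period P}. vector_derivative (demand P) (at_right t))"
  then obtain \<Lambda> where lip: "taubar_slope_bound P \<Lambda>" using taubar_slope_bound_exists by blast
  obtain c where c: "\<And>S M. 0 < S \<Longrightarrow> 0 < M \<Longrightarrow> total_time S M \<le> c * (S * M ^ 3)"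
    using total_time_bound by blast
  show "\<exists>K L :: real. \<forall>S M :: nat. 0 < S \<and> 0 < M \<and> (\<exists>d y. feasible P S d y) \<longrightarrow>
      (\<exists>n s. exec P shuttle_program (input_store S M) n s \<and>
        real n \<le> K * (real S * real M ^ 3) \<and>
        feasible P S (rarr s ''d'') (rarr s ''y'') \<and>
        g_ave P S (rarr s ''d'') (rarr s ''y'') \<le> OPT P S + L * (real S ^ 2 / real M))"
  proof (rule exI[of _ "real c"], rule exI[of _ "error_constant P \<Lambda>"], intro allI impI)
    fix S M :: nat
    assume *: "0 < S \<and> 0 < M \<and> (\<exists>d y. feasible P S d y)"
    then obtain n s where ns: "exec P shuttle_program (input_store S M) n s" "n \<le> total_time S M"
      "feasible P S (rarr s ''d'') (rarr s ''y'')"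
      "g_ave P S (rarr s ''d'') (rarr s ''y'') \<le>
        OPT P S + error_constant P \<Lambda> * (real S ^ 2 / real M)"
      using shuttle_program_runs[of P \<Lambda> M S] P lip unfolding runs_def by blast
    have "real n \<le> real (c * (S * M ^ 3))" using ns(2) c[of S M] * by linarith
    then have "real n \<le> real c * (real S * real M ^ 3)" by simp
    then show "\<exists>n s. exec P shuttle_program (input_store S M) n s \<and>
        real n \<le> real c * (real S * real M ^ 3) \<and>
        feasible P S (rarr s ''d'') (rarr s ''y'') \<and>
        g_ave P S (rarr s ''d'') (rarr s ''y'') \<le>
          OPT P S + error_constant P \<Lambda> * (real S ^ 2 / real M)" using ns by blast
  qed
qed

end
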